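(* Let $D$ be an integral domain. The space $\mathrm{SStar}_{f,sp}(D)$ of the stable semistar operations of finite type on $D$, endowed with the Zariski topology induced by $\mathrm{SStar}(D)$, is a spectral space.
   Context: Let $K$ be the quotient field of $D$, $\overline{\mathbf F}(D)$ the set of nonzero $D$-submodules of $K$, $\mathbf f(D)$ the set of nonzero finitely generated fractional ideals of $D$. A semistar operation on $D$ is a map $\star:\overline{\mathbf F}(D)\to\overline{\mathbf F}(D)$, $E\mapsto E^\star$, such that for all $0\ne z\in K$ and $E,F\in\overline{\mathbf F}(D)$: $(zE)^\star=zE^\star$; $E\subseteq F\Rightarrow E^\star\subseteq F^\star$; $E\subseteq E^\star$; $(E^\star)^\star=E^\star$. $\mathrm{SStar}(D)$ is the set of all semistar operations on $D$; its Zariski topology has as subbasis of open sets the sets $V_E:=\{\star\in\mathrm{SStar}(D)\mid 1\in E^\star\}$, $E\in\overline{\mathbf F}(D)$. A semistar operation $\star$ is of finite type if $E^\star=\bigcup\{F^\star\mid F\subseteq E,F\in\mathbf f(D)\}$ for all $E\in\overline{\mathbf F}(D)$; it is stable if $(E\cap H)^\star=E^\star\cap H^\star$ for all $E,H\in\overline{\mathbf F}(D)$. $\mathrm{SStar}_{f,sp}(D)$ is the set of semistar operations of finite type that are stable; equivalently (a known fact), it is the set of semistar operations of finite type that are spectral, i.e. of the form $E\mapsto\bigcap\{ED_P\mid P\in Y\}$ for some $Y\subseteq\mathrm{Spec}(D)$ (the empty intersection being $K$). A spectral space is a topological space homeomorphic to the prime spectrum of a commutative ring with the Zariski topology. *)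

theory Defs
  imports
    "HOL-Analysis.Abstract_Topology"
    "HOL-Computational_Algebra.Fraction_Field"
    "HOL-Algebra.Ideal"
begin

section \<open>Spectral spaces\<close>

definition Spec :: "('r, 'm) ring_scheme \<Rightarrow> 'r set set" where
  "Spec R = {P. primeideal P R}"

definition Zariski_Spec :: "('r, 'm) ring_scheme \<Rightarrow> 'r set topology" where
  "Zariski_Spec R = topology (\<lambda>U. \<exists>S \<subseteq> carrier R. U = Spec R - {P \<in> Spec R. S \<subseteq> P})"

lemma istopology_Zariski_Spec:
  fixes R (structure)
  shows "istopology (\<lambda>U. \<exists>S \<subseteq> carrier R. U = Spec R - {P \<in> Spec R. S \<subseteq> P})"
  unfolding istopology_def
proof (intro conjI allI impI)
  fix U V
  assume "\<exists>S \<subseteq> carrier R. U = Spec R - {P \<in> Spec R. S \<subseteq> P}"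
    and "\<exists>S \<subseteq> carrier R. V = Spec R - {P \<in> Spec R. S \<subseteq> P}"
  then obtain S T where S: "S \<subseteq> carrier R" "U = Spec R - {P \<in> Spec R. S \<subseteq> P}"
    and T: "T \<subseteq> carrier R" "V = Spec R - {P \<in> Spec R. T \<subseteq> P}" by blast
  let ?W = "{w \<in> carrier R. \<exists>s\<in>S. \<exists>t\<in>T. w = s \<otimes> t}"
  have "?W \<subseteq> P \<longleftrightarrow> S \<subseteq> P \<or> T \<subseteq> P" if "P \<in> Spec R" for P
  proof -
    interpret primeideal P R using that by (simp add: Spec_def)
    show ?thesis
    proof
      assume W: "?W \<subseteq> P"
      show "S \<subseteq> P \<or> T \<subseteq> P"
      proof (rule ccontr)
        assume "\<not> (S \<subseteq> P \<or> T \<subseteq> P)"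
        then obtain s t where "s \<in> S" "s \<notin> P" "t \<in> T" "t \<notin> P" by blast
        moreover from this have "s \<in> carrier R" "t \<in> carrier R"
          using S(1) T(1) by auto
        moreover from calculation have "s \<otimes> t \<in> ?W"
          by (intro CollectI conjI bexI[of _ s] bexI[of _ t] m_closed refl)
        ultimately show False using I_prime[of s t] W by (meson subsetD)
      qed
    next
      assume "S \<subseteq> P \<or> T \<subseteq> P"
      then show "?W \<subseteq> P"
        using S(1) T(1) I_l_closed I_r_closed by (smt (verit) mem_Collect_eq subsetD subsetI)
    qed
  qed
  then have "\<exists>W. W = ?W \<and> (\<forall>P\<in>Spec R. W \<subseteq> P \<longleftrightarrow> S \<subseteq> P \<or> T \<subseteq> P)" by simp
  then obtain W where W: "W = ?W" "\<forall>P\<in>Spec R. W \<subseteq> P \<longleftrightarrow> S \<subseteq> P \<or> T \<subseteq> P" by blast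
  have "U \<inter> V = Spec R - {P \<in> Spec R. W \<subseteq> P}" unfolding S(2) T(2) using W(2) by blast
  moreover have "W \<subseteq> carrier R" unfolding W(1) by (rule Collect_restrict)
  ultimately show "\<exists>S \<subseteq> carrier R. U \<inter> V = Spec R - {P \<in> Spec R. S \<subseteq> P}"
    by (intro exI[of _ W] conjI)
next
  fix \<K> :: "'a set set set"
  assume "\<forall>K\<in>\<K>. \<exists>S \<subseteq> carrier R. K = Spec R - {P \<in> Spec R. S \<subseteq> P}"
  then have "\<forall>K\<in>\<K>. \<exists>S. S \<subseteq> carrier R \<and> K = Spec R - {P \<in> Spec R. S \<subseteq> P}"
    by blast
  from bchoice[OF this] obtain f
    where f: "\<forall>K\<in>\<K>. f K \<subseteq> carrier R \<and> K = Spec R - {P \<in> Spec R. f K \<subseteq> P}"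
    by (rule exE)
  have "\<Union>\<K> = (\<Union>K\<in>\<K>. Spec R - {P \<in> Spec R. f K \<subseteq> P})"
    using SUP_cong[of \<K> \<K> "\<lambda>K. K", OF refl conjunct2[OF bspec[OF f]]]
    by (simp only: image_ident)
  also have "\<dots> = Spec R - {P \<in> Spec R. (\<Union>K\<in>\<K>. f K) \<subseteq> P}"
    by blast
  finally show "\<exists>S \<subseteq> carrier R. \<Union>\<K> = Spec R - {P \<in> Spec R. S \<subseteq> P}"
    by (intro exI[of _ "\<Union>K\<in>\<K>. f K"] conjI UN_least conjunct1[OF bspec[OF f]])
qed

text \<open>
  HOL cannot quantify existentially over the type carrying the ring, so the definition fixes one
  that is large enough for every space on the type \<open>'x\<close>. Hochster's construction realises a
  spectral space \<open>X\<close> by a subring of a product, indexed by \<open>X\<close>, of fields of rational functions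
  over a countable field in variables indexed by (some of the) open sets of \<open>X\<close>. Such a ring embeds
  into \<open>X \<Rightarrow> F\<close> with \<open>F\<close> of cardinality at most that of \<open>nat \<times> 'x set\<close>, hence into
  \<open>(nat \<times> 'x set) set\<close>. The factor \<open>nat\<close> matters when \<open>'x\<close> is finite.
\<close>

definition spectral_space :: "'x topology \<Rightarrow> bool" where
  "spectral_space X \<longleftrightarrow>
    (\<exists>R :: (nat \<times> 'x set) set ring. cring R \<and> X homeomorphic_space Zariski_Spec R)"


section \<open>Semistar operations\<close>

text \<open>The integral domain \<open>D\<close> is the type \<open>'a :: idom\<close>; its quotient field is \<open>'a fract\<close>.\<close>

definition of_dom :: "'a::idom \<Rightarrow> 'a fract" where
  "of_dom d = Fraction_Field.Fract d 1"

global_interpretation fract: module "\<lambda>(d :: 'a::idom) (x :: 'a fract). of_dom d * x"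
  defines submodule = fract.subspace
    and generated_submodule = fract.span
proof unfold_locales
  fix a b :: 'a and x y :: "'a fract"
  show "of_dom a * (x + y) = of_dom a * x + of_dom a * y"
    by (rule distrib_left)
  have "of_dom (a + b) = of_dom a + of_dom b" "of_dom (a * b) = of_dom a * of_dom b"
    unfolding of_dom_def by (simp_all only: add_fract mult_fract one_neq_zero not_False_eq_True mult_1_right)
  then show "of_dom (a + b) * x = of_dom a * x + of_dom b * x"
    and "of_dom a * (of_dom b * x) = of_dom (a * b) * x"
    by (simp_all only: distrib_right mult.assoc)
  show "of_dom 1 * x = x"
    unfolding of_dom_def One_fract_def[symmetric] by (rule mult_1_left)
qed

definition Fbar :: "'a::idom fract set set" where
  "Fbar = {E. submodule E \<and> E \<noteq> {0}}"

definition fractional_ideal :: "'a::idom fract set \<Rightarrow> bool" where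
  "fractional_ideal I \<longleftrightarrow>
    submodule I \<and> (\<exists>d. d \<noteq> 0 \<and> (\<lambda>x. of_dom d * x) ` I \<subseteq> range of_dom)"

definition fg_frac_ideals :: "'a::idom fract set set" where
  "fg_frac_ideals =
    {F. fractional_ideal F \<and> F \<noteq> {0} \<and> (\<exists>S. finite S \<and> F = generated_submodule S)}"

text \<open>
  A map on \<^term>\<open>Fbar\<close> is encoded as a total function that is \<^term>\<open>undefined\<close> outside
  \<^term>\<open>Fbar\<close>, so that two semistar operations are equal iff they agree on \<^term>\<open>Fbar\<close>.
\<close>

definition SStar :: "('a::idom fract set \<Rightarrow> 'a fract set) set" where
  "SStar = {st \<in> Fbar \<rightarrow>\<^sub>E Fbar.
     (\<forall>z E. z \<noteq> 0 \<longrightarrow> E \<in> Fbar \<longrightarrow> st ((*) z ` E) = (*) z ` st E) \<and>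
     (\<forall>E\<in>Fbar. \<forall>F\<in>Fbar. E \<subseteq> F \<longrightarrow> st E \<subseteq> st F) \<and>
     (\<forall>E\<in>Fbar. E \<subseteq> st E) \<and>
     (\<forall>E\<in>Fbar. st (st E) = st E)}"

definition Zariski_SStar :: "('a::idom fract set \<Rightarrow> 'a fract set) topology" where
  "Zariski_SStar = topology_generated_by {{st \<in> SStar. 1 \<in> st E} | E. E \<in> Fbar}"

lemma topspace_Zariski_SStar: "topspace Zariski_SStar = (SStar :: ('a::idom fract set \<Rightarrow> _) set)"
proof -
  have "(UNIV :: 'a fract set) \<noteq> {0}"
    using one_neq_zero[where 'a = "'a fract"] by blast
  then have "(UNIV :: 'a fract set) \<in> Fbar"
    unfolding Fbar_def using fract.subspace_UNIV by blast
  moreover from this have "1 \<in> st UNIV" if "st \<in> SStar" for st :: "'a fract set \<Rightarrow> 'a fract set"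
    using that \<open>UNIV \<in> Fbar\<close> unfolding SStar_def by blast
  ultimately show ?thesis
    unfolding Zariski_SStar_def topology_generated_by_topspace by blast
qed

definition finite_type :: "('a::idom fract set \<Rightarrow> 'a fract set) \<Rightarrow> bool" where
  "finite_type st \<longleftrightarrow> (\<forall>E\<in>Fbar. st E = \<Union>{st F | F. F \<subseteq> E \<and> F \<in> fg_frac_ideals})"

definition stable :: "('a::idom fract set \<Rightarrow> 'a fract set) \<Rightarrow> bool" where
  "stable st \<longleftrightarrow> (\<forall>E\<in>Fbar. \<forall>H\<in>Fbar. st (E \<inter> H) = st E \<inter> st H)"

definition SStar_f_sp :: "('a::idom fract set \<Rightarrow> 'a fract set) set" where
  "SStar_f_sp = {st \<in> SStar. finite_type st \<and> stable st}"

end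

theory Submission
  imports
    Defs
    "HOL-Library.Poly_Mapping"
    "HOL-Computational_Algebra.Formal_Laurent_Series"
    "HOL-Algebra.Weak_Morphisms"
begin

text \<open>
  The proof has two halves: the operations form a closed subset of a power set, and every closed
  subset of a power set is a spectral space.

  \<^bold>\<open>Semistar operations.\<close> If \<open>\<star>\<close> is stable and of finite type, then \<open>1 \<in> E\<^sup>\<star>\<close> holds iff
  \<open>1 \<in> I\<^sup>\<star>\<close> for some nonzero finitely generated ideal \<open>I \<subseteq> E\<close> of \<open>D\<close>: stability replaces \<open>E\<close> by
  \<open>E \<inter> D\<close>, and finite type then provides \<open>I\<close> (lemma \<open>ex_fg_ideal\<close>). So \<open>\<star>\<close> is determined by the set
  \<open>J\<close> of these ideals \<open>I\<close> with \<open>1 \<in> I\<^sup>\<star>\<close>, and the Zariski topology is generated by the conditions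
  \<open>I \<in> J\<close>. The sets \<open>J\<close> that arise are the localizing systems (\<open>localizing_SStar\<close>,
  \<open>semistar_of_SStar_f_sp\<close>). Their axioms are closure conditions that each involve finitely many
  ideals, because the ideals are finitely generated; hence a pointwise limit of localizing systems
  is again one (\<open>localizing_limit\<close>). This is closedness in the patch topology.

  \<^bold>\<open>Spectral spaces.\<close> A \<open>T\<^sub>0\<close> space \<open>X\<close> with a subbasis \<open>\<B>\<close> is spectral if the sets
  \<open>{B \<in> \<B>. p \<in> B}\<close>, for \<open>p \<in> X\<close>, form a closed subset of the power set of \<open>\<B>\<close>
  (\<open>spectral_space_patch_closed\<close>, a form of Hochster's theorem). Write \<open>N p\<close> for this set, so that
  \<open>p\<close> lies in the closure of \<open>q\<close> iff \<open>N p \<subseteq> N q\<close>. Let \<open>K\<close> be the field of rational functions in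
  variables \<open>x\<^sub>B\<close>, \<open>B \<in> \<B>\<close>, and for a set \<open>F\<close> of variables let \<open>\<sigma>\<^sub>F : K \<rightarrow> K((t))\<close> multiply by \<open>t\<close>
  the variables outside \<open>F\<close>. The order in \<open>t\<close> of \<open>\<sigma>\<^sub>F z\<close> is a valuation of \<open>z\<close>, and setting \<open>t = 0\<close>
  is its place. The ring consists of the functions \<open>g : X \<rightarrow> K\<close> that depend on finitely many of
  the conditions \<open>p \<in> B\<close> and satisfy: if \<open>N p \<subseteq> N q\<close>, then \<open>\<sigma>\<^bsub>N p\<^esub> (g q)\<close> becomes \<open>g p\<close> at \<open>t = 0\<close>.
  It contains the coordinate functions, equal to \<open>x\<^sub>B\<close> on \<open>B\<close> and to \<open>0\<close> elsewhere.

  The crux is \<open>power_divisible\<close>: if \<open>s\<close> vanishes wherever \<open>w\<close> does, then \<open>w\<close> divides a power of \<open>s\<close>.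
  The orders of the values of \<open>w\<close> are bounded, so that for large \<open>n\<close> the quotient \<open>s\<^sup>n / w\<close> has positive
  order at every specialization at which \<open>w\<close> vanishes, and the value \<open>0\<close> there is the right one. Prime
  ideals therefore depend on supports only. The coordinate functions outside a prime \<open>P\<close> form a set
  \<open>J \<subseteq> \<B>\<close> which is approximated by sets \<open>N p\<close>, so closedness gives \<open>J = N p\<close>; and patch
  compactness, which confines supports by finitely many members of \<open>\<B>\<close>, gives
  \<open>P = {g. g p = 0}\<close> (\<open>primeideal_is_point\<close>).
\<close>

section \<open>Rational functions and the scaling of variables\<close>

text \<open>
  Polynomials over an integral domain form an integral domain when their monomials are linearly
  ordered. The variables are to be indexed by arbitrary types, hence this copy of a type with a
  linear order that a choice of well-ordering provides.
\<close>

typedef 'a wellordered = "UNIV :: 'a set" by simp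

instantiation wellordered :: (type) linorder
begin

definition "x \<le> y \<longleftrightarrow>
  (Rep_wellordered x, Rep_wellordered y) \<in> (SOME r :: 'a rel. Well_order r \<and> Field r = UNIV)"

definition "(x :: 'a wellordered) < y \<longleftrightarrow> x \<le> y \<and> \<not> y \<le> x"

instance
proof
  define r where "r = (SOME r :: 'a rel. Well_order r \<and> Field r = UNIV)"
  have r: "Well_order r" "Field r = UNIV"
    using someI_ex[OF well_ordering[where 'a = 'a]] unfolding r_def by auto
  have le: "x \<le> y \<longleftrightarrow> (Rep_wellordered x, Rep_wellordered y) \<in> r" for x y :: "'a wellordered"
    by (simp add: less_eq_wellordered_def r_def)
  have lin: "linear_order_on UNIV r"
    using r by (simp add: well_order_on_def)
  fix x y z :: "'a wellordered"
  show "(x < y) = (x \<le> y \<and> \<not> y \<le> x)" by (rule less_wellordered_def)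
  show "x \<le> x"
    using lin by (simp add: le order_on_defs refl_on_def)
  show "x \<le> y \<Longrightarrow> y \<le> z \<Longrightarrow> x \<le> z"
    using lin by (auto simp add: le order_on_defs elim: transE)
  show "x \<le> y \<Longrightarrow> y \<le> x \<Longrightarrow> x = y"
    using lin by (auto simp add: le order_on_defs Rep_wellordered_inject dest: antisymD)
  show "x \<le> y \<or> y \<le> x"
    using lin by (cases "x = y") (auto simp add: le order_on_defs total_on_def Rep_wellordered_inject refl_on_def)
qed

end

lemma poly_mapping_sum_single: "p = (\<Sum>m\<in>Poly_Mapping.keys p. Poly_Mapping.single m (Poly_Mapping.lookup p m))"
  by (rule poly_mapping_eqI) (simp add: lookup_sum lookup_single when_def in_keys_iff)

lemma linear_extension_add:
  fixes f :: "'m \<Rightarrow> 'c::comm_monoid_add \<Rightarrow> 'b::comm_monoid_add"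
  assumes "\<And>m. f m 0 = 0" "\<And>m c d. f m (c + d) = f m c + f m d"
  shows "(\<Sum>m\<in>Poly_Mapping.keys (p + q). f m (Poly_Mapping.lookup (p + q) m))
     = (\<Sum>m\<in>Poly_Mapping.keys p. f m (Poly_Mapping.lookup p m)) + (\<Sum>m\<in>Poly_Mapping.keys q. f m (Poly_Mapping.lookup q m))"
  using setsum_keys_plus_distrib[of f p q] assms by simp

text \<open>
  A map on monomials with coefficients that is additive in the coefficient and multiplicative
  extends to a multiplicative map on polynomials.
\<close>

lemma linear_extension_mult:
  fixes f :: "'m::monoid_add \<Rightarrow> 'c::semiring_0 \<Rightarrow> 'b::semiring_0"
  assumes f0: "\<And>m. f m 0 = 0" and fadd: "\<And>m c d. f m (c + d) = f m c + f m d"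
    and fmult: "\<And>m n c d. f (m + n) (c * d) = f m c * f n d"
  shows "(\<Sum>m\<in>Poly_Mapping.keys (p * q). f m (Poly_Mapping.lookup (p * q) m))
     = (\<Sum>m\<in>Poly_Mapping.keys p. f m (Poly_Mapping.lookup p m)) * (\<Sum>m\<in>Poly_Mapping.keys q. f m (Poly_Mapping.lookup q m))"
proof -
  define L where "L = (\<lambda>p. \<Sum>m\<in>Poly_Mapping.keys p. f m (Poly_Mapping.lookup p m))"
  have L0: "L 0 = 0" by (simp add: L_def)
  have Ladd: "L (p + q) = L p + L q" for p q
    unfolding L_def by (rule linear_extension_add[OF f0 fadd])
  have Lsum: "L (sum g A) = (\<Sum>a\<in>A. L (g a))" for g :: "'z \<Rightarrow> _" and A
    by (induction A rule: infinite_finite_induct) (simp_all add: L0 Ladd)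
  have Lsingle: "L (Poly_Mapping.single m c) = f m c" for m c
    by (cases "c = 0") (simp_all add: L_def f0)
  have "p * q = (\<Sum>m\<in>Poly_Mapping.keys p. \<Sum>n\<in>Poly_Mapping.keys q.
      Poly_Mapping.single (m + n) (Poly_Mapping.lookup p m * Poly_Mapping.lookup q n))"
    by (subst poly_mapping_sum_single[of p], subst poly_mapping_sum_single[of q])
       (simp add: sum_product mult_single)
  then have "L (p * q) = (\<Sum>m\<in>Poly_Mapping.keys p. \<Sum>n\<in>Poly_Mapping.keys q.
      f m (Poly_Mapping.lookup p m) * f n (Poly_Mapping.lookup q n))"
    by (simp add: Lsum Lsingle fmult)
  then show ?thesis by (simp add: L_def sum_product)
qed

definition degree_outside :: "'v set \<Rightarrow> ('v \<Rightarrow>\<^sub>0 nat) \<Rightarrow> nat" where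
  "degree_outside F m = (\<Sum>i\<in>Poly_Mapping.keys m - F. Poly_Mapping.lookup m i)"

lemma degree_outside_add: "degree_outside F (m + n) = degree_outside F m + degree_outside F n"
proof -
  have eq: "degree_outside F k = (\<Sum>i\<in>A - F. Poly_Mapping.lookup k i)"
    if "finite A" "Poly_Mapping.keys k \<subseteq> A" for A k
    unfolding degree_outside_def
    by (rule sum.mono_neutral_left) (use that in \<open>auto simp: in_keys_iff\<close>)
  let ?A = "Poly_Mapping.keys m \<union> Poly_Mapping.keys n"
  show ?thesis
    using Poly_Mapping.keys_add[of m n]
    by (subst (1 2 3) eq[of ?A]) (auto simp: lookup_add sum.distrib)
qed

lemma degree_outside_0 [simp]: "degree_outside F 0 = 0"
  by (simp add: degree_outside_def)

lemma degree_outside_cong: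
  "F \<inter> Poly_Mapping.keys m = F' \<inter> Poly_Mapping.keys m \<Longrightarrow> degree_outside F m = degree_outside F' m"
  unfolding degree_outside_def by (rule arg_cong[where f = "sum _"]) blast

type_synonym 'v int_mpoly = "('v \<Rightarrow>\<^sub>0 nat) \<Rightarrow>\<^sub>0 int"

type_synonym 'v ratfun = "'v int_mpoly fract"

lemma of_dom_simps:
  "of_dom (a + b) = of_dom a + of_dom b" "of_dom (a * b) = of_dom a * of_dom b"
  "of_dom 0 = 0" "of_dom 1 = 1" "of_dom a = 0 \<longleftrightarrow> a = 0"
  by (simp_all add: of_dom_def Zero_fract_def One_fract_def eq_fract)

lemma of_dom_sum: "of_dom (sum g A) = (\<Sum>a\<in>A. of_dom (g a))"
  by (induction A rule: infinite_finite_induct) (simp_all add: of_dom_simps)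

text \<open>
  On polynomials, \<^term>\<open>scale_poly F p\<close> is the result of substituting \<open>t * x\<^sub>i\<close> for each variable
  \<open>x\<^sub>i\<close> with \<open>i \<notin> F\<close>, as a power series (in fact a polynomial) in \<open>t\<close>.
\<close>

definition scale_poly :: "'v set \<Rightarrow> 'v::linorder int_mpoly \<Rightarrow> 'v ratfun fps" where
  "scale_poly F p = (\<Sum>m\<in>Poly_Mapping.keys p.
     fps_const (of_dom (Poly_Mapping.single m (Poly_Mapping.lookup p m))) * fps_X ^ degree_outside F m)"

lemma scale_poly_add: "scale_poly F (p + q) = scale_poly F p + scale_poly F q"
  unfolding scale_poly_def
  by (rule linear_extension_add)
     (simp_all add: of_dom_simps single_add fps_const_add[symmetric] distrib_right del: fps_const_add)

lemma scale_poly_mult: "scale_poly F (p * q) = scale_poly F p * scale_poly F q"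
  unfolding scale_poly_def
proof (rule linear_extension_mult)
  fix m n :: "'a \<Rightarrow>\<^sub>0 nat" and c d :: int
  have "of_dom (Poly_Mapping.single (m + n) (c * d)) = of_dom (Poly_Mapping.single m c) * of_dom (Poly_Mapping.single n d)"
    by (simp add: of_dom_simps(2)[symmetric] mult_single)
  then show "fps_const (of_dom (Poly_Mapping.single (m + n) (c * d))) * fps_X ^ degree_outside F (m + n) =
       fps_const (of_dom (Poly_Mapping.single m c)) * fps_X ^ degree_outside F m *
       (fps_const (of_dom (Poly_Mapping.single n d)) * fps_X ^ degree_outside F n)"
    by (simp add: degree_outside_add power_add fps_const_mult[symmetric] mult_ac del: fps_const_mult)
qed (simp_all add: of_dom_simps single_add fps_const_add[symmetric] distrib_right del: fps_const_add)

lemma scale_poly_single: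
  "scale_poly F (Poly_Mapping.single m c) = fps_const (of_dom (Poly_Mapping.single m c)) * fps_X ^ degree_outside F m"
  by (cases "c = 0") (simp_all add: scale_poly_def of_dom_simps)

text \<open>
  The substitution only sorts the monomials of \<open>p\<close> by their degree in the variables outside \<open>F\<close>, so
  none of them can be cancelled.
\<close>

lemma scale_poly_eq_0_iff: "scale_poly F p = 0 \<longleftrightarrow> p = 0"
proof
  assume p: "scale_poly F p = 0"
  show "p = 0"
  proof (rule ccontr)
    assume "p \<noteq> 0"
    then obtain m where m: "m \<in> Poly_Mapping.keys p" by (metis all_not_in_conv keys_eq_empty)
    let ?d = "degree_outside F"
    define q where "q = (\<Sum>n\<in>{n\<in>Poly_Mapping.keys p. ?d n = ?d m}. Poly_Mapping.single n (Poly_Mapping.lookup p n))"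
    have "fps_nth (scale_poly F p) (?d m)
       = (\<Sum>n\<in>Poly_Mapping.keys p. if ?d m = ?d n then of_dom (Poly_Mapping.single n (Poly_Mapping.lookup p n)) else 0)"
      by (simp add: scale_poly_def fps_sum_nth fps_X_power_mult_right_nth fps_X_power_nth if_distrib mult_delta_right
           cong: if_cong)
    also have "\<dots> = of_dom q"
      unfolding q_def of_dom_sum by (rule sum.mono_neutral_cong_right) (auto)
    finally have "q = 0" using p by (simp add: of_dom_simps)
    moreover have "Poly_Mapping.lookup q m = Poly_Mapping.lookup p m"
      using m by (simp add: q_def lookup_sum lookup_single when_def in_keys_iff)
    ultimately show False using m by (simp add: in_keys_iff)
  qed
qed (simp add: scale_poly_def)

text \<open>
  The extension of \<^term>\<open>scale_poly F\<close> to quotients, computed on an arbitrary representation as a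
  fraction; \<open>scale_Fract\<close> shows that the choice is immaterial.
\<close>

definition scale :: "'v set \<Rightarrow> 'v::linorder ratfun \<Rightarrow> 'v ratfun fls" where
  "scale F z = (case (SOME (a, b). b \<noteq> 0 \<and> z = Fraction_Field.Fract a b) of
     (a, b) \<Rightarrow> fps_to_fls (scale_poly F a) / fps_to_fls (scale_poly F b))"

lemma scale_Fract:
  assumes "b \<noteq> 0"
  shows "scale F (Fraction_Field.Fract a b) = fps_to_fls (scale_poly F a) / fps_to_fls (scale_poly F b)"
proof -
  obtain c d where cd: "(SOME (c, d). d \<noteq> 0 \<and> Fraction_Field.Fract a b = Fraction_Field.Fract c d) = (c, d)"
    by fastforce
  have "(case (c, d) of (c, d) \<Rightarrow> d \<noteq> 0 \<and> Fraction_Field.Fract a b = Fraction_Field.Fract c d)"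
    unfolding cd[symmetric] by (rule someI[of _ "(a, b)"]) (use assms in simp)
  then have d: "d \<noteq> 0" and "a * d = c * b"
    using assms by (auto simp: eq_fract)
  then have "scale_poly F a * scale_poly F d = scale_poly F c * scale_poly F b"
    by (metis scale_poly_mult)
  then have "fps_to_fls (scale_poly F a) * fps_to_fls (scale_poly F d)
     = fps_to_fls (scale_poly F c) * fps_to_fls (scale_poly F b)"
    by (metis fls_times_fps_to_fls)
  then show ?thesis
    using assms d by (simp add: scale_def cd frac_eq_eq scale_poly_eq_0_iff)
qed

lemma scale_add: "scale F (y + z) = scale F y + scale F z"
proof (cases y, cases z)
  fix a b c d :: "'a int_mpoly"
  assume yz: "y = Fraction_Field.Fract a b" "b \<noteq> 0" "z = Fraction_Field.Fract c d" "d \<noteq> 0"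
  define h where "h p = fps_to_fls (scale_poly F p)" for p
  have h: "h (p + q) = h p + h q" "h (p * q) = h p * h q" "h p = 0 \<longleftrightarrow> p = 0" for p q
    by (simp_all add: h_def scale_poly_add scale_poly_mult scale_poly_eq_0_iff fls_times_fps_to_fls)
  have "scale F (y + z) = (h a * h d + h c * h b) / (h b * h d)"
    using yz by (simp add: scale_Fract h h_def[symmetric])
  also have "\<dots> = h a / h b + h c / h d"
    using yz(2,4) by (intro add_frac_eq[symmetric]) (simp_all add: h)
  finally show "scale F (y + z) = scale F y + scale F z"
    using yz by (simp add: scale_Fract h_def)
qed

lemma scale_mult: "scale F (y * z) = scale F y * scale F z"
  by (cases y, cases z) (simp add: scale_Fract scale_poly_mult fls_times_fps_to_fls)

lemma scale_poly_1: "scale_poly F 1 = 1"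
  using scale_poly_single[of F 0 1] by (simp add: of_dom_simps)

lemma scale_1: "scale F 1 = 1"
  using scale_Fract[of 1 F 1] by (simp add: One_fract_def scale_poly_1)

definition var :: "'v::linorder \<Rightarrow> 'v ratfun" where
  "var i = of_dom (Poly_Mapping.single (Poly_Mapping.single i 1) 1)"

lemma var_nonzero: "var i \<noteq> 0"
  by (metis of_dom_simps(5) lookup_single_eq lookup_zero var_def zero_neq_one)

lemma scale_var: "scale F (var i) = (if i \<in> F then fls_const (var i) else fls_X * fls_const (var i))"
  by (auto simp: var_def of_dom_def scale_Fract scale_poly_1 scale_poly_single degree_outside_def insert_Diff_if
      fls_times_fps_to_fls mult_ac)

text \<open>
  Only the variables that occur in a numerator and a denominator of \<open>z\<close> matter.
\<close>

lemma scale_finite_dependence: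
  "\<exists>S. finite S \<and> (\<forall>F F'. F \<inter> S = F' \<inter> S \<longrightarrow> scale F z = scale F' z)"
proof (cases z)
  case (Fract a b)
  define S where "S = (\<Union>m\<in>Poly_Mapping.keys a \<union> Poly_Mapping.keys b. Poly_Mapping.keys m)"
  have "scale_poly F p = scale_poly F' p"
    if "F \<inter> S = F' \<inter> S" "Poly_Mapping.keys p \<subseteq> Poly_Mapping.keys a \<union> Poly_Mapping.keys b" for F F' p
  proof -
    have "degree_outside F m = degree_outside F' m" if m: "m \<in> Poly_Mapping.keys p" for m
    proof (rule degree_outside_cong)
      have "Poly_Mapping.keys m \<subseteq> S" using m \<open>Poly_Mapping.keys p \<subseteq> _\<close> by (auto simp: S_def)
      then show "F \<inter> Poly_Mapping.keys m = F' \<inter> Poly_Mapping.keys m"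
        using \<open>F \<inter> S = F' \<inter> S\<close> by blast
    qed
    then show ?thesis unfolding scale_poly_def by (intro sum.cong) auto
  qed
  then have "scale F z = scale F' z" if "F \<inter> S = F' \<inter> S" for F F'
    unfolding Fract(1) scale_Fract[OF Fract(2)] using that by (metis Un_upper1 Un_upper2)
  moreover have "finite S" by (simp add: S_def)
  ultimately show ?thesis by blast
qed

section \<open>Values of Laurent series at the origin\<close>

text \<open>
  The place of the Laurent series field at \<open>t = 0\<close>, as a relation: \<open>f\<close> has no pole and its value
  is \<open>r\<close>.
\<close>

definition reduces_to :: "'k::field fls \<Rightarrow> 'k \<Rightarrow> bool" (infix "\<leadsto>" 50) where
  "f \<leadsto> r \<longleftrightarrow> (\<exists>h. f = fps_to_fls h \<and> fps_nth h 0 = r)"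

lemma reduces_to_const: "fls_const c \<leadsto> c"
  unfolding reduces_to_def by (rule exI[of _ "fps_const c"]) simp

lemma reduces_to_X: "fls_X * fls_const c \<leadsto> (0 :: 'k::field)"
  unfolding reduces_to_def
  by (rule exI[of _ "fps_X * fps_const c"]) (simp add: fls_times_fps_to_fls)

lemma reduces_to_0_unique: "0 \<leadsto> r \<Longrightarrow> r = 0"
  by (auto simp: reduces_to_def)

lemma reduces_to_add: "f \<leadsto> r \<Longrightarrow> g \<leadsto> s \<Longrightarrow> f + g \<leadsto> r + s"
  unfolding reduces_to_def by (metis fps_to_fls_plus fps_add_nth)

lemma reduces_to_mult: "f \<leadsto> r \<Longrightarrow> g \<leadsto> s \<Longrightarrow> f * g \<leadsto> r * s"
  unfolding reduces_to_def by (metis fls_times_fps_to_fls fps_mult_nth_0)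

lemma reduces_to_0: "0 \<leadsto> 0"
  using reduces_to_const[of 0] by simp

lemma reduces_to_1: "1 \<leadsto> 1"
  using reduces_to_const[of 1] by simp

lemma reduces_to_power: "f \<leadsto> r \<Longrightarrow> f ^ n \<leadsto> r ^ n"
  by (induction n) (simp_all add: reduces_to_1 reduces_to_mult)

lemma reduces_to_divide:
  assumes "f \<leadsto> r" "g \<leadsto> s" "s \<noteq> 0"
  shows "f / g \<leadsto> r / s"
proof -
  obtain h where h: "g = fps_to_fls h" "fps_nth h 0 = s"
    using assms(2) by (auto simp: reduces_to_def)
  then have "h * inverse h = 1" using assms(3) by (simp add: inverse_mult_eq_1')
  then have "inverse g = fps_to_fls (inverse h)"
    by (metis h(1) fls_times_fps_to_fls fps_one_to_fls inverse_unique)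
  then have "inverse g \<leadsto> inverse s"
    using h(2) assms(3) by (auto simp: reduces_to_def)
  then show ?thesis
    using reduces_to_mult[OF assms(1)] by (simp add: divide_inverse)
qed

text \<open>
  A zero of \<open>f\<close> of positive order outweighs any given zero of \<open>g\<close> after taking a sufficiently high
  power.
\<close>

lemma reduces_to_power_divide:
  fixes f g :: "'k::field fls"
  assumes f: "f \<leadsto> 0" and g: "g \<leadsto> s" "g \<noteq> 0" and n: "int n > fls_subdegree g"
  shows "f ^ n / g \<leadsto> 0"
proof -
  obtain h where h: "f = fps_to_fls h" "fps_nth h 0 = 0" using f by (auto simp: reduces_to_def)
  obtain k where k: "g = fps_to_fls k" using g by (auto simp: reduces_to_def)
  with g have "k \<noteq> 0" by auto
  define d u where "d = subdegree k" and "u = fps_shift d k"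
  have d: "d < n" using n by (simp add: k d_def fls_subdegree_fls_to_fps)
  have ku: "k = u * fps_X ^ d" unfolding u_def d_def by (rule subdegree_decompose)
  have "fps_nth u 0 \<noteq> 0" using \<open>k \<noteq> 0\<close> by (simp add: u_def d_def)
  then have u: "inverse u * u = 1" by (rule inverse_mult_eq_1)
  define h' where "h' = fps_shift 1 h"
  have h': "h = fps_X * h'"
    by (rule fps_ext) (simp add: h'_def h(2))
  define w where "w = fps_X ^ (n - d) * h' ^ n * inverse u"
  have "w * k = fps_X ^ (n - d) * fps_X ^ d * h' ^ n * (inverse u * u)"
    by (simp add: w_def ku mult_ac)
  also have "\<dots> = h ^ n"
    using d u by (simp add: h' power_mult_distrib power_add[symmetric])
  finally have "fps_to_fls w * g = f ^ n"
    by (metis h(1) k fls_times_fps_to_fls fps_to_fls_power)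
  then have "f ^ n / g = fps_to_fls w" using g(2) by (simp add: nonzero_divide_eq_eq)
  moreover have "fps_nth w 0 = 0" using d by (simp add: w_def)
  ultimately show ?thesis by (auto simp: reduces_to_def)
qed

text \<open>
  The properties of the field of rational functions on which the construction of the ring rests:
  each set \<open>F\<close> of variables gives an embedding \<open>\<sigma> F\<close> into Laurent series that fixes the variables in
  \<open>F\<close> and gives the other ones order \<open>1\<close>.
\<close>

locale weighted_field =
  fixes x :: "'i \<Rightarrow> 'k::field" and \<sigma> :: "'i set \<Rightarrow> 'k \<Rightarrow> 'k fls"
  assumes \<sigma>_add: "\<sigma> F (y + z) = \<sigma> F y + \<sigma> F z"
    and \<sigma>_mult: "\<sigma> F (y * z) = \<sigma> F y * \<sigma> F z"
    and \<sigma>_1: "\<sigma> F 1 = 1"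
    and x_nonzero: "x i \<noteq> 0"
    and \<sigma>_x: "\<sigma> F (x i) = (if i \<in> F then fls_const (x i) else fls_X * fls_const (x i))"
    and \<sigma>_finite: "\<exists>S. finite S \<and> (\<forall>F F'. F \<inter> S = F' \<inter> S \<longrightarrow> \<sigma> F z = \<sigma> F' z)"
begin

lemma \<sigma>_0: "\<sigma> F 0 = 0"
  using \<sigma>_add[of F 0 0] by (metis add.right_neutral add_left_cancel)

lemma \<sigma>_minus: "\<sigma> F (- z) = - \<sigma> F z"
  using \<sigma>_add[of F z "- z"] by (simp add: \<sigma>_0 eq_neg_iff_add_eq_0 add.commute)

lemma \<sigma>_inverse: "\<sigma> F (inverse z) = inverse (\<sigma> F z)"
proof (cases "z = 0")
  case False
  then have "\<sigma> F z * \<sigma> F (inverse z) = 1"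
    by (simp add: \<sigma>_mult[symmetric] \<sigma>_1)
  then show ?thesis by (metis inverse_unique)
qed (simp add: \<sigma>_0)

lemma \<sigma>_divide: "\<sigma> F (y / z) = \<sigma> F y / \<sigma> F z"
  by (simp add: divide_inverse \<sigma>_mult \<sigma>_inverse)

lemma \<sigma>_power: "\<sigma> F (z ^ n) = \<sigma> F z ^ n"
  by (induction n) (simp_all add: \<sigma>_1 \<sigma>_mult)

lemma \<sigma>_eq_0_iff: "\<sigma> F z = 0 \<longleftrightarrow> z = 0"
proof
  assume "\<sigma> F z = 0"
  then have "\<sigma> F (z * inverse z) = 0" by (simp add: \<sigma>_mult)
  then show "z = 0" by (metis \<sigma>_1 right_inverse zero_neq_one)
qed (simp add: \<sigma>_0)

lemma finite_range_\<sigma>: "finite (range (\<lambda>F. \<sigma> F z))"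
proof -
  from \<sigma>_finite[of z] obtain S where S: "finite S"
    and dep: "\<forall>F F'. F \<inter> S = F' \<inter> S \<longrightarrow> \<sigma> F z = \<sigma> F' z" by (elim exE conjE)
  have "\<sigma> F z = \<sigma> (F \<inter> S) z" for F
    by (rule dep[rule_format]) (simp only: Int_assoc Int_absorb)
  then have "range (\<lambda>F. \<sigma> F z) \<subseteq> (\<lambda>F. \<sigma> F z) ` Pow S"
    by (metis (no_types, lifting) Int_lower2 PowI image_eqI image_subsetI)
  moreover have "finite ((\<lambda>F. \<sigma> F z) ` Pow S)" using S by simp
  ultimately show ?thesis by (rule finite_subset)
qed

text \<open>
  Keep one variable and give all others positive order: the sum then reduces to that variable.
\<close>

lemma sum_x_nonzero:
  assumes "finite T" "T \<noteq> {}"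
  shows "(\<Sum>i\<in>T. x i) \<noteq> 0"
proof
  assume 0: "(\<Sum>i\<in>T. x i) = 0"
  obtain j where j: "j \<in> T" using assms by blast
  have sum: "\<sigma> F (sum x A) = (\<Sum>i\<in>A. \<sigma> F (x i))" for F A
    by (induction A rule: infinite_finite_induct) (simp_all add: \<sigma>_0 \<sigma>_add)
  have red: "(\<Sum>i\<in>A. \<sigma> {j} (x i)) \<leadsto> 0" if "j \<notin> A" for A
    using that by (induction A rule: infinite_finite_induct)
      (auto simp: \<sigma>_x reduces_to_0 intro!: reduces_to_add[of _ 0 _ 0, simplified] reduces_to_X)
  have "\<sigma> {j} (sum x T) \<leadsto> x j + 0"
    unfolding sum.remove[OF assms(1) j] \<sigma>_add sum
    by (intro reduces_to_add red) (simp_all add: \<sigma>_x reduces_to_const)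
  then show False using 0 x_nonzero[of j] by (auto simp: \<sigma>_0 dest: reduces_to_0_unique)
qed

end

text \<open>
  Transport along \<^const>\<open>Abs_wellordered\<close> gives rational functions in variables indexed by an
  arbitrary type.
\<close>

lemma weighted_field_ratfun:
  "weighted_field (\<lambda>i :: 'i. var (Abs_wellordered i)) (\<lambda>F. scale (Abs_wellordered ` F))"
proof
  fix F :: "'i set" and i :: 'i and z :: "'i wellordered ratfun"
  show "scale (Abs_wellordered ` F) (var (Abs_wellordered i)) =
    (if i \<in> F then fls_const (var (Abs_wellordered i)) else fls_X * fls_const (var (Abs_wellordered i)))"
    by (simp add: scale_var image_iff Abs_wellordered_inject)
  obtain S where S: "finite S" "\<forall>F F'. F \<inter> S = F' \<inter> S \<longrightarrow> scale F z = scale F' z"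
    using scale_finite_dependence[of z] by (elim exE conjE)
  show "\<exists>S. finite S \<and> (\<forall>F F'. F \<inter> S = F' \<inter> S \<longrightarrow>
      scale (Abs_wellordered ` F) z = scale (Abs_wellordered ` F') z)"
  proof (intro exI[of _ "Rep_wellordered ` S"] conjI allI impI)
    fix F F' :: "'i set" assume FF': "F \<inter> Rep_wellordered ` S = F' \<inter> Rep_wellordered ` S"
    have "Abs_wellordered ` G \<inter> S = Abs_wellordered ` (G \<inter> Rep_wellordered ` S)" for G
    proof
      show "Abs_wellordered ` G \<inter> S \<subseteq> Abs_wellordered ` (G \<inter> Rep_wellordered ` S)"
      proof (intro subsetI, elim IntE imageE)
        fix y x assume y: "y \<in> S" "y = Abs_wellordered x" "x \<in> G"
        then have "x \<in> Rep_wellordered ` S" by (metis Abs_wellordered_inverse UNIV_I imageI)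
        then show "y \<in> Abs_wellordered ` (G \<inter> Rep_wellordered ` S)" using y by blast
      qed
    qed (auto simp: Rep_wellordered_inverse)
    then show "scale (Abs_wellordered ` F) z = scale (Abs_wellordered ` F') z"
      using FF' by (intro S(2)[rule_format]) simp
  qed (use S(1) in simp)
qed (simp_all add: scale_add scale_mult scale_1 var_nonzero)

section \<open>The Zariski topology of a ring\<close>

lemma openin_Zariski_Spec_iff:
  "openin (Zariski_Spec R) U \<longleftrightarrow> (\<exists>S \<subseteq> carrier R. U = Spec R - {P \<in> Spec R. S \<subseteq> P})"
  unfolding Zariski_Spec_def topology_inverse'[OF istopology_Zariski_Spec] ..

lemma topspace_Zariski_Spec: "topspace (Zariski_Spec R) = Spec R"
proof -
  have "\<not> carrier R \<subseteq> P" if "P \<in> Spec R" for P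
  proof -
    interpret primeideal P R using that by (simp add: Spec_def)
    show ?thesis using a_subset I_notcarr by blast
  qed
  then have "Spec R = Spec R - {P \<in> Spec R. carrier R \<subseteq> P}" by blast
  then have "openin (Zariski_Spec R) (Spec R)"
    unfolding openin_Zariski_Spec_iff by (intro exI[of _ "carrier R"] conjI subset_refl)
  moreover have "U \<subseteq> Spec R" if "openin (Zariski_Spec R) U" for U
    using that by (auto simp: openin_Zariski_Spec_iff)
  ultimately show ?thesis by (metis openin_subset openin_topspace subset_antisym)
qed

lemma continuous_map_Zariski_Spec:
  assumes "h \<in> ring_hom R S" "cring R" "cring S"
  shows "continuous_map (Zariski_Spec S) (Zariski_Spec R) (\<lambda>Q. {r \<in> carrier R. h r \<in> Q})"
proof -
  interpret ring_hom_ring R S h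
    using assms by (intro ring_hom_ringI2) (simp_all add: cring.axioms(1))
  have vimage: "{r \<in> carrier R. h r \<in> Q} \<in> Spec R" if "Q \<in> Spec S" for Q
    using primeideal_vimage[OF assms(2)] that by (simp add: Spec_def)
  show ?thesis
    unfolding continuous_map topspace_Zariski_Spec
  proof (intro conjI allI impI)
    show "(\<lambda>Q. {r \<in> carrier R. h r \<in> Q}) ` Spec S \<subseteq> Spec R" using vimage by blast
    fix U assume "openin (Zariski_Spec R) U"
    then obtain T where T: "T \<subseteq> carrier R" "U = Spec R - {P \<in> Spec R. T \<subseteq> P}"
      unfolding openin_Zariski_Spec_iff by blast
    have "{Q \<in> Spec S. {r \<in> carrier R. h r \<in> Q} \<in> U} = Spec S - {Q \<in> Spec S. h ` T \<subseteq> Q}"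
      using T vimage by auto
    moreover have "h ` T \<subseteq> carrier S" using T(1) by auto
    ultimately show "openin (Zariski_Spec S) {Q \<in> Spec S. {r \<in> carrier R. h r \<in> Q} \<in> U}"
      unfolding openin_Zariski_Spec_iff by blast
  qed
qed

lemma homeomorphic_Zariski_Spec_ring_iso:
  assumes h: "h \<in> ring_iso R S" and R: "cring R" and S: "cring S"
  shows "Zariski_Spec R homeomorphic_space Zariski_Spec S"
proof -
  interpret R: cring R by (rule R)
  interpret S: cring S by (rule S)
  define k where "k = inv_into (carrier R) h"
  have k: "k \<in> ring_iso S R" unfolding k_def by (rule ring_iso_set_sym[OF R.ring_axioms h])
  have bij: "bij_betw h (carrier R) (carrier S)" by (rule ring_iso_memE(5)[OF h])
  have hk: "h (k s) = s" if "s \<in> carrier S" for s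
    using that bij by (simp add: k_def bij_betw_inv_into_right)
  have kh: "k (h r) = r" if "r \<in> carrier R" for r
    using that bij by (simp add: k_def bij_betw_inv_into_left)
  have carr: "h r \<in> carrier S" if "r \<in> carrier R" for r using ring_iso_memE(1)[OF h] that .
  have carr': "k s \<in> carrier R" if "s \<in> carrier S" for s using ring_iso_memE(1)[OF k] that .
  have sub: "P \<subseteq> carrier A" if "P \<in> Spec A" for P and A :: "('z, 'y) ring_scheme"
  proof -
    interpret primeideal P A using that by (simp add: Spec_def)
    show ?thesis by (rule a_subset)
  qed
  have "homeomorphic_maps (Zariski_Spec R) (Zariski_Spec S)
    (\<lambda>P. {s \<in> carrier S. k s \<in> P}) (\<lambda>Q. {r \<in> carrier R. h r \<in> Q})"
    unfolding homeomorphic_maps_def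
  proof (intro conjI ballI)
    show "continuous_map (Zariski_Spec R) (Zariski_Spec S) (\<lambda>P. {s \<in> carrier S. k s \<in> P})"
      using k R S by (intro continuous_map_Zariski_Spec) (simp_all add: ring_iso_def)
    show "continuous_map (Zariski_Spec S) (Zariski_Spec R) (\<lambda>Q. {r \<in> carrier R. h r \<in> Q})"
      using h R S by (intro continuous_map_Zariski_Spec) (simp_all add: ring_iso_def)
    show "{r \<in> carrier R. h r \<in> {s \<in> carrier S. k s \<in> P}} = P" if "P \<in> topspace (Zariski_Spec R)" for P
    proof -
      have "P \<subseteq> carrier R" using that sub[of P R] by (simp add: topspace_Zariski_Spec)
      then show ?thesis using kh carr by auto
    qed
    show "{s \<in> carrier S. k s \<in> {r \<in> carrier R. h r \<in> Q}} = Q" if "Q \<in> topspace (Zariski_Spec S)" for Q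
    proof -
      have "Q \<subseteq> carrier S" using that by (simp add: topspace_Zariski_Spec Spec_def
         additive_subgroup.a_subset ideal.axioms(1) primeideal.axioms(1))
      then show ?thesis using hk carr' by auto
    qed
  qed
  then show ?thesis by (auto simp: homeomorphic_space_def)
qed

text \<open>
  The definition of a spectral space asks for a ring on a particular type; any ring whose carrier
  can be injected into that type will do.
\<close>

lemma spectral_spaceI:
  fixes X :: "'x topology" and R :: "'r ring" and e :: "'r \<Rightarrow> (nat \<times> 'x set) set"
  assumes R: "cring R" and X: "X homeomorphic_space Zariski_Spec R" and e: "inj_on e (carrier R)"
  shows "spectral_space X"
proof -
  have iso: "e \<in> ring_iso R (image_ring e R)" by (rule inj_imp_image_ring_iso[OF e])
  have "cring (image_ring e R)"
    using cring.ring_iso_imp_img_cring[OF R iso]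
    by (simp add: image_ring_def image_group_def monoid.defs)
  moreover from this have "X homeomorphic_space Zariski_Spec (image_ring e R)"
    using homeomorphic_Zariski_Spec_ring_iso[OF iso R] X by (metis homeomorphic_space_trans)
  ultimately show ?thesis unfolding spectral_space_def by blast
qed

section \<open>Compactness of the patch topology\<close>

text \<open>
  A \<open>T\<^sub>0\<close> space given by a subbasis, whose image under \<open>p \<mapsto> {B \<in> \<B>. p \<in> B}\<close> is closed in the power
  set of \<open>\<B>\<close>: a set of subbasic sets that agrees on every finite part of \<open>\<B>\<close> with the image of some
  point is itself the image of a point.
\<close>

locale patch_closed =
  fixes \<B> :: "'p set set"
    and points :: "'p set"
    and nbhds :: "'p \<Rightarrow> 'p set set"
  defines "points \<equiv> \<Union>\<B>"
    and "nbhds p \<equiv> {B \<in> \<B>. p \<in> B}"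
  assumes separated: "\<And>p q. p \<in> points \<Longrightarrow> q \<in> points \<Longrightarrow> nbhds p = nbhds q \<Longrightarrow> p = q"
    and closed: "\<And>J. J \<subseteq> \<B> \<Longrightarrow>
      (\<And>S. finite S \<Longrightarrow> S \<subseteq> \<B> \<Longrightarrow> \<exists>p\<in>points. nbhds p \<inter> S = J \<inter> S) \<Longrightarrow> \<exists>p\<in>points. nbhds p = J"
begin

lemma nbhds_subset: "nbhds p \<subseteq> \<B>"
  by (auto simp: nbhds_def)

lemma in_nbhds_iff: "B \<in> \<B> \<Longrightarrow> B \<in> nbhds p \<longleftrightarrow> p \<in> B"
  by (auto simp: nbhds_def)

text \<open>
  Compactness of the patch topology for the conditions that occur below: membership in all sets of
  \<open>C\<close>, in no set of \<open>E\<close>, and a property \<open>Q\<close> that is decided by a finite set \<open>S\<close> of subbasic sets. A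
  maximal set \<open>M\<close> of membership conditions that stays finitely satisfiable decides every subbasic set,
  since a rejected \<open>B\<close> is excluded by finitely many conditions of \<open>M\<close> and \<open>E\<close>; so \<open>M\<close> is approximated
  by points, and closedness applies.
\<close>

lemma patch_compact:
  assumes CE: "C \<subseteq> \<B>" "E \<subseteq> \<B>"
    and S: "finite S" "S \<subseteq> \<B>"
    and Q: "\<And>p q. p \<in> points \<Longrightarrow> q \<in> points \<Longrightarrow> nbhds p \<inter> S = nbhds q \<inter> S \<Longrightarrow> Q p \<Longrightarrow> Q q"
    and fin: "\<And>T W. finite T \<Longrightarrow> T \<subseteq> C \<Longrightarrow> finite W \<Longrightarrow> W \<subseteq> E \<Longrightarrow>
      \<exists>p\<in>points. T \<subseteq> nbhds p \<and> W \<inter> nbhds p = {} \<and> Q p"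
  shows "\<exists>p\<in>points. C \<subseteq> nbhds p \<and> E \<inter> nbhds p = {} \<and> Q p"
proof -
  define sat where "sat T W \<longleftrightarrow> (\<exists>p\<in>points. T \<subseteq> nbhds p \<and> W \<inter> nbhds p = {} \<and> Q p)" for T W
  define good where "good J \<longleftrightarrow> J \<subseteq> \<B> \<and> C \<subseteq> J \<and>
    (\<forall>T W. finite T \<and> T \<subseteq> J \<and> finite W \<and> W \<subseteq> E \<longrightarrow>
sat T W)" for J
  have goodD: "\<exists>p\<in>points. T \<subseteq> nbhds p \<and> W \<inter> nbhds p = {} \<and> Q p"
    if "good J" "finite T" "T \<subseteq> J" "finite W" "W \<subseteq> E" for J T W
    using that unfolding good_def sat_def by blast
  have "good C" unfolding good_def sat_def using CE fin by blast
  have "\<exists>M\<in>Collect good. \<forall>J\<in>Collect good. M \<subseteq> J \<longrightarrow> J = M"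
  proof (rule subset_Zorn_nonempty)
    show "Collect good \<noteq> {}" using \<open>good C\<close> by blast
    fix \<C> assume \<C>: "\<C> \<noteq> {}" "subset.chain (Collect good) \<C>"
    then have sub: "\<C> \<subseteq> Collect good" by (simp add: subset.chain_def)
    have "\<exists>p\<in>points. T \<subseteq> nbhds p \<and> W \<inter> nbhds p = {} \<and> Q p"
      if TW: "finite T" "T \<subseteq> \<Union>\<C>" "finite W" "W \<subseteq> E" for T W
    proof -
      obtain J where "J \<in> \<C>" "T \<subseteq> J"
        using finite_subset_Union_chain[OF TW(1,2) \<C>] by blast
      then show ?thesis using sub TW goodD[of J T W] by blast
    qed
    moreover have "J \<subseteq> \<B> \<and> C \<subseteq> J" if "J \<in> \<C>" for J
      using subsetD[OF sub that] by (simp add: good_def)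
    then have "\<Union>\<C> \<subseteq> \<B>" "C \<subseteq> \<Union>\<C>"
      using \<C>(1) by (blast, blast)
    ultimately have "good (\<Union>\<C>)" unfolding good_def sat_def by simp
    then show "\<Union>\<C> \<in> Collect good" by simp
  qed
  then obtain M where M: "good M" and max: "\<And>J. good J \<Longrightarrow> M \<subseteq> J \<Longrightarrow> J = M"
    by blast
  have "M \<subseteq> \<B>" "C \<subseteq> M" using M by (auto simp: good_def)
  have "\<exists>T W. finite T \<and> T \<subseteq> M \<and> finite W \<and> W \<subseteq> E \<and>
      (\<forall>p\<in>points. T \<subseteq> nbhds p \<longrightarrow> W \<inter> nbhds p = {} \<longrightarrow> Q p \<longrightarrow> B \<notin> nbhds p)"
    if "B \<in> \<B> - M" for B
  proof -
    have "\<not> good (insert B M)" using max[of "insert B M"] that by blast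
    moreover have "insert B M \<subseteq> \<B>" "C \<subseteq> insert B M" using that \<open>M \<subseteq> \<B>\<close> \<open>C \<subseteq> M\<close> by auto
    ultimately have "\<not> (\<forall>T W. finite T \<and> T \<subseteq> insert B M \<and> finite W \<and> W \<subseteq> E \<longrightarrow> sat T W)"
      unfolding good_def by simp
    then obtain T W where "finite T" "T \<subseteq> insert B M" "finite W" "W \<subseteq> E" "\<not> sat T W" by auto
    moreover from this have "T - {B} \<subseteq> M" by blast
    moreover have "B \<notin> nbhds p"
      if "p \<in> points" "T - {B} \<subseteq> nbhds p" "W \<inter> nbhds p = {}" "Q p" for p
      using that \<open>\<not> sat T W\<close> unfolding sat_def by blast
    ultimately show ?thesis
      by (metis finite_Diff)
  qed
  then have "\<forall>B\<in>\<B> - M. \<exists>TW. finite (fst TW) \<and> fst TW \<subseteq> M \<and> finite (snd TW) \<and> snd TW \<subseteq> E \<and>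
      (\<forall>p\<in>points. fst TW \<subseteq> nbhds p \<longrightarrow> snd TW \<inter> nbhds p = {} \<longrightarrow> Q p \<longrightarrow> B \<notin> nbhds p)"
    by simp
  from bchoice[OF this] obtain tw where tw: "\<forall>B\<in>\<B> - M. finite (fst (tw B)) \<and> fst (tw B) \<subseteq> M \<and>
      finite (snd (tw B)) \<and> snd (tw B) \<subseteq> E \<and>
      (\<forall>p\<in>points. fst (tw B) \<subseteq> nbhds p \<longrightarrow> snd (tw B) \<inter> nbhds p = {} \<longrightarrow> Q p \<longrightarrow> B \<notin> nbhds p)" ..
  \<comment> \<open>\<open>tw B\<close> consists of the finitely many conditions that exclude \<open>B\<close> in the presence of \<open>Q\<close>.\<close>
  have realized: "\<exists>p\<in>points. nbhds p \<inter> S' = M \<inter> S' \<and> Q p" if S': "finite S'" "S' \<subseteq> \<B>" for S'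
  proof -
    define T where "T = (S' \<inter> M) \<union> (\<Union>B\<in>S' - M. fst (tw B))"
    define W where "W = (\<Union>B\<in>S' - M. snd (tw B))"
    have "finite T" "T \<subseteq> M" "finite W" "W \<subseteq> E"
    proof -
      have *: "finite (fst (tw B)) \<and> fst (tw B) \<subseteq> M \<and> finite (snd (tw B)) \<and> snd (tw B) \<subseteq> E"
        if "B \<in> S' - M" for B
        using bspec[OF tw, of B] that S'(2) by blast
      show "finite T" "finite W" unfolding T_def W_def using S'(1) * by auto
      show "T \<subseteq> M" "W \<subseteq> E" unfolding T_def W_def using * by blast+
    qed
    then obtain p where p: "p \<in> points" "T \<subseteq> nbhds p" "W \<inter> nbhds p = {}" "Q p"
      using goodD[OF M \<open>finite T\<close> \<open>T \<subseteq> M\<close> \<open>finite W\<close> \<open>W \<subseteq> E\<close>] by (elim bexE conjE)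
    have "B \<notin> nbhds p" if "B \<in> S' - M" for B
    proof -
      have "fst (tw B) \<subseteq> T" "snd (tw B) \<subseteq> W" using that by (auto simp: T_def W_def)
      then have "fst (tw B) \<subseteq> nbhds p" "snd (tw B) \<inter> nbhds p = {}" using p(2,3) by auto
      moreover have "B \<in> \<B> - M" using that S'(2) by blast
      note tw[THEN bspec, OF this, THEN conjunct2, THEN conjunct2, THEN conjunct2, THEN conjunct2,
          THEN bspec, OF p(1)]
      ultimately show ?thesis using p(4) by simp
    qed
    then have "nbhds p \<inter> S' = M \<inter> S'" using p(2) by (auto simp: T_def)
    then show ?thesis using p(1,4) by (intro bexI[of _ p]) simp
  qed
  have "\<exists>z\<in>points. nbhds z = M"
    by (rule closed[OF \<open>M \<subseteq> \<B>\<close>], drule (1) realized) (elim bexE conjE, rule bexI)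
  then obtain z where z: "z \<in> points" "nbhds z = M" by (elim bexE)
  have "B \<notin> M" if "B \<in> E" for B
  proof
    assume "B \<in> M"
    then show False using goodD[OF M, of "{B}" "{B}"] that by blast
  qed
  then have "E \<inter> nbhds z = {}" using z(2) by blast
  moreover from realized[OF S] obtain p where "p \<in> points" "nbhds p \<inter> S = M \<inter> S" "Q p"
    by (elim bexE conjE)
  then have "Q z" using Q[of p z] z by simp
  ultimately show ?thesis using z \<open>C \<subseteq> M\<close> by (intro bexI[of _ z]) simp_all
qed

end

section \<open>The ring of regular functions\<close>

locale spectral_subbase = patch_closed \<B> points nbhds + weighted_field x \<sigma>
  for \<B> :: "'p set set" and points nbhds and x :: "'p set \<Rightarrow> 'k::field" and \<sigma> :: "'p set set \<Rightarrow> 'k \<Rightarrow> 'k fls"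
begin

text \<open>
  Besides dependence on finitely many subbasic sets, a regular function has to be compatible with
  specialization: \<open>nbhds p \<subseteq> nbhds q\<close> says that \<open>p\<close> lies in the closure of \<open>q\<close>, and then \<open>g p\<close> is the
  value of \<open>g q\<close> at the place of \<open>nbhds p\<close>. For \<open>q = p\<close> the condition forces every nonzero value
  \<open>g p\<close> to have order \<open>0\<close> at its own place. Consequently zeros spread to specializations, and a
  nonzero value \<open>g q\<close> has positive order at the place of \<open>p\<close> iff \<open>g p = 0\<close>.
\<close>

definition regular :: "('p \<Rightarrow> 'k) set" where
  "regular = {g. (\<forall>p. p \<notin> points \<longrightarrow> g p = 0) \<and>
     (\<forall>p\<in>points. \<forall>q\<in>points. nbhds p \<subseteq> nbhds q \<longrightarrow> \<sigma> (nbhds p) (g q) \<leadsto> g p) \<and>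
     (\<exists>S. finite S \<and> S \<subseteq> \<B> \<and> (\<forall>p\<in>points. \<forall>q\<in>points. nbhds p \<inter> S = nbhds q \<inter> S \<longrightarrow> g p = g q))}"

lemma regular_outside: "g \<in> regular \<Longrightarrow> p \<notin> points \<Longrightarrow> g p = 0"
  by (simp add: regular_def)

lemma regular_reduce:
  "g \<in> regular \<Longrightarrow> p \<in> points \<Longrightarrow> q \<in> points \<Longrightarrow> nbhds p \<subseteq> nbhds q \<Longrightarrow> \<sigma> (nbhds p) (g q) \<leadsto> g p"
  by (simp add: regular_def)

lemma regular_finite:
  "g \<in> regular \<Longrightarrow> \<exists>S. finite S \<and> S \<subseteq> \<B> \<and>
    (\<forall>p\<in>points. \<forall>q\<in>points. nbhds p \<inter> S = nbhds q \<inter> S \<longrightarrow> g p = g q)"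
  unfolding regular_def by (elim CollectE conjE)

text \<open>
  A pointwise operation on two regular functions inherits finite dependence; compatibility with
  specialization remains to be checked for each operation.
\<close>

lemma regular_I2:
  assumes g: "g \<in> regular" and h: "h \<in> regular"
    and out: "\<And>p. p \<notin> points \<Longrightarrow> op (g p) (h p) = 0"
    and red: "\<And>p q. p \<in> points \<Longrightarrow> q \<in> points \<Longrightarrow> nbhds p \<subseteq> nbhds q \<Longrightarrow>
        \<sigma> (nbhds p) (op (g q) (h q)) \<leadsto> op (g p) (h p)"
  shows "(\<lambda>p. op (g p) (h p)) \<in> regular"
proof -
  from regular_finite[OF g] obtain S where S: "finite S" "S \<subseteq> \<B>"
    "\<forall>p\<in>points. \<forall>q\<in>points. nbhds p \<inter> S = nbhds q \<inter> S \<longrightarrow> g p = g q"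
    by (elim exE conjE)
  from regular_finite[OF h] obtain T where T: "finite T" "T \<subseteq> \<B>"
    "\<forall>p\<in>points. \<forall>q\<in>points. nbhds p \<inter> T = nbhds q \<inter> T \<longrightarrow> h p = h q"
    by (elim exE conjE)
  have "\<exists>S. finite S \<and> S \<subseteq> \<B> \<and> (\<forall>p\<in>points. \<forall>q\<in>points. nbhds p \<inter> S = nbhds q \<inter> S \<longrightarrow>
      op (g p) (h p) = op (g q) (h q))"
  proof (intro exI[of _ "S \<union> T"] conjI ballI impI)
    fix p q assume pq: "p \<in> points" "q \<in> points" "nbhds p \<inter> (S \<union> T) = nbhds q \<inter> (S \<union> T)"
    then have "nbhds p \<inter> S = nbhds q \<inter> S" "nbhds p \<inter> T = nbhds q \<inter> T" by auto
    then show "op (g p) (h p) = op (g q) (h q)"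
      using S(3)[rule_format, OF pq(1,2)] T(3)[rule_format, OF pq(1,2)] by simp
  qed (use S(1,2) T(1,2) in auto)
  then show ?thesis using out red unfolding regular_def by (intro CollectI conjI ballI allI impI)
qed

lemma regular_add: "g \<in> regular \<Longrightarrow> h \<in> regular \<Longrightarrow> (\<lambda>p. g p + h p) \<in> regular"
  by (rule regular_I2) (auto simp: regular_outside \<sigma>_add intro!: reduces_to_add regular_reduce)

lemma regular_mult: "g \<in> regular \<Longrightarrow> h \<in> regular \<Longrightarrow> (\<lambda>p. g p * h p) \<in> regular"
  by (rule regular_I2) (auto simp: regular_outside \<sigma>_mult intro!: reduces_to_mult regular_reduce)

lemma regular_0: "(\<lambda>p. 0) \<in> regular"
  unfolding regular_def by (auto simp: \<sigma>_0 reduces_to_0 intro!: exI[of _ "{}"])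

lemma regular_1: "(\<lambda>p. if p \<in> points then 1 else 0) \<in> regular"
  unfolding regular_def by (auto simp: \<sigma>_1 reduces_to_1 intro!: exI[of _ "{}"])

lemma regular_minus: "g \<in> regular \<Longrightarrow> (\<lambda>p. - g p) \<in> regular"
proof (rule regular_I2[where op = "\<lambda>a b. - a"])
  fix p q assume "g \<in> regular" "p \<in> points" "q \<in> points" "nbhds p \<subseteq> nbhds q"
  then have "\<sigma> (nbhds p) (g q) \<leadsto> g p" by (rule regular_reduce)
  then have "fls_const (-1) * \<sigma> (nbhds p) (g q) \<leadsto> (-1) * g p"
    by (intro reduces_to_mult reduces_to_const)
  then show "\<sigma> (nbhds p) (- g q) \<leadsto> - g p" by (simp add: \<sigma>_minus)
qed (auto simp: regular_outside)

lemma regular_power: "g \<in> regular \<Longrightarrow> n > 0 \<Longrightarrow> (\<lambda>p. g p ^ n) \<in> regular"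
  by (rotate_tac, induction n rule: nat_induct_non_zero) (simp_all add: regular_mult)

definition coordinate :: "'p set \<Rightarrow> 'p \<Rightarrow> 'k" where
  "coordinate B p = (if p \<in> points \<and> p \<in> B then x B else 0)"

lemma coordinate_eq_0_iff: "p \<in> points \<Longrightarrow> coordinate B p = 0 \<longleftrightarrow> p \<notin> B"
  by (simp add: coordinate_def x_nonzero)

lemma coordinate_regular:
  assumes "B \<in> \<B>"
  shows "coordinate B \<in> regular"
proof -
  have "\<exists>S. finite S \<and> S \<subseteq> \<B> \<and> (\<forall>p\<in>points. \<forall>q\<in>points. nbhds p \<inter> S = nbhds q \<inter> S \<longrightarrow>
      coordinate B p = coordinate B q)"
  proof (intro exI[of _ "{B}"] conjI ballI impI)
    fix p q assume pq: "p \<in> points" "q \<in> points" "nbhds p \<inter> {B} = nbhds q \<inter> {B}"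
    then have "B \<in> nbhds p \<longleftrightarrow> B \<in> nbhds q" by blast
    then show "coordinate B p = coordinate B q"
      using pq(1,2) assms by (simp add: coordinate_def nbhds_def)
  qed (use assms in auto)
  moreover have "\<sigma> (nbhds p) (coordinate B q) \<leadsto> coordinate B p"
    if "p \<in> points" "q \<in> points" "nbhds p \<subseteq> nbhds q" for p q
  proof -
    have eq: "coordinate B r = (if B \<in> nbhds r then x B else 0)" if "r \<in> points" for r
      using assms that by (simp add: coordinate_def in_nbhds_iff)
    consider "B \<notin> nbhds q" | "B \<in> nbhds q" "B \<notin> nbhds p" | "B \<in> nbhds q" "B \<in> nbhds p" by blast
    then show ?thesis
    proof cases
      case 1
      moreover have "B \<notin> nbhds p" using 1 that(3) by blast
      ultimately show ?thesis by (simp add: eq that \<sigma>_0 reduces_to_0)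
    next
      case 2
      then show ?thesis by (simp only: eq that \<sigma>_x if_True if_False reduces_to_X)
    next
      case 3
      then show ?thesis by (simp only: eq that \<sigma>_x if_True reduces_to_const)
    qed
  qed
  ultimately show ?thesis by (simp add: regular_def coordinate_def)
qed

text \<open>
  A regular function has finitely many values, and each of them depends on finitely many variables,
  so only finitely many Laurent series occur.
\<close>

lemma bounded_order:
  assumes w: "w \<in> regular"
  shows "\<exists>M. \<forall>p\<in>points. \<forall>q\<in>points. fls_subdegree (\<sigma> (nbhds p) (w q)) < int M"
proof -
  from regular_finite[OF w] obtain S where S: "finite S" "S \<subseteq> \<B>"
    "\<forall>p\<in>points. \<forall>q\<in>points. nbhds p \<inter> S = nbhds q \<inter> S \<longrightarrow> w p = w q"
    by (elim exE conjE)
  have "finite (w ` points)"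
  proof (rule inj_on_finite)
    \<comment> \<open>Each value is recovered from the trace on \<open>S\<close> of a point at which it is taken.\<close>
    define rep where "rep a = nbhds (SOME p. p \<in> points \<and> w p = a) \<inter> S" for a
    have rep: "\<exists>p\<in>points. w p = a \<and> rep a = nbhds p \<inter> S" if "a \<in> w ` points" for a
    proof -
      from that have "\<exists>p. p \<in> points \<and> w p = a" by blast
      from someI_ex[OF this] show ?thesis by (auto simp: rep_def)
    qed
    show "inj_on rep (w ` points)"
    proof (rule inj_onI)
      fix a b assume "a \<in> w ` points" "b \<in> w ` points" "rep a = rep b"
      then show "a = b" using rep[of a] rep[of b] S(3) by metis
    qed
    show "rep ` w ` points \<subseteq> Pow S" by (auto simp: rep_def)
    show "finite (Pow S)" using S(1) by simp
  qed
  then have "finite (\<Union>a\<in>w ` points. range (\<lambda>F. \<sigma> F a))"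
    by (rule finite_UN_I) (rule finite_range_\<sigma>)
  then have fin: "finite (nat ` fls_subdegree ` (\<Union>a\<in>w ` points. range (\<lambda>F. \<sigma> F a)))" by simp
  show ?thesis
  proof (intro exI ballI)
    fix p q assume "p \<in> points" "q \<in> points"
    then have "nat (fls_subdegree (\<sigma> (nbhds p) (w q))) \<in> nat ` fls_subdegree ` (\<Union>a\<in>w ` points. range (\<lambda>F. \<sigma> F a))"
      by blast
    from Max_ge[OF fin this] show "fls_subdegree (\<sigma> (nbhds p) (w q))
       < int (Suc (Max (nat ` fls_subdegree ` (\<Union>a\<in>w ` points. range (\<lambda>F. \<sigma> F a)))))"
      by linarith
  qed
qed

text \<open>
  The pointwise quotient of \<open>s\<^sup>n\<close> by \<open>w\<close> is regular for large \<open>n\<close>. The critical case is a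
  specialization \<open>p\<close> of \<open>q\<close> with \<open>w p = 0\<close> and \<open>w q \<noteq> 0\<close>: the quotient is \<open>0\<close> at \<open>p\<close>, and at \<open>q\<close> it must
  have positive order at the place of \<open>p\<close>. As \<open>s q\<close> has positive order, this holds as soon as \<open>n\<close>
  exceeds the orders of the values of \<open>w\<close>. It is this case in which a power of \<open>s\<close> is required.
\<close>

lemma power_divisible:
  assumes s: "s \<in> regular" and w: "w \<in> regular"
    and supp: "\<And>p. p \<in> points \<Longrightarrow> w p = 0 \<Longrightarrow> s p = 0"
  obtains n h where "n > 0" "h \<in> regular" "(\<lambda>p. s p ^ n) = (\<lambda>p. w p * h p)"
proof -
  from bounded_order[OF w] obtain M where
    M: "\<forall>p\<in>points. \<forall>q\<in>points. fls_subdegree (\<sigma> (nbhds p) (w q)) < int M" ..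
  define n where "n = Suc M"
  have "(\<lambda>p. s p ^ n / w p) \<in> regular"
  proof (rule regular_I2[OF s w])
    show "s p ^ n / w p = 0" if "p \<notin> points" for p using w that by (simp add: regular_outside)
    fix p q assume pq: "p \<in> points" "q \<in> points" "nbhds p \<subseteq> nbhds q"
    have red: "\<sigma> (nbhds p) (s q) \<leadsto> s p" "\<sigma> (nbhds p) (w q) \<leadsto> w p"
      using s w pq by (auto intro: regular_reduce)
    have "\<sigma> (nbhds p) (s q) ^ n / \<sigma> (nbhds p) (w q) \<leadsto> s p ^ n / w p"
    proof (cases "w p = 0")
      case False
      then show ?thesis using red by (intro reduces_to_divide reduces_to_power)
    next
      case True
      then have sp: "s p = 0" using supp pq by blast
      show ?thesis
      proof (cases "w q = 0")
        case True
        then show ?thesis using \<open>w p = 0\<close> by (simp add: \<sigma>_0 reduces_to_0)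
      next
        case False
        then have "\<sigma> (nbhds p) (w q) \<noteq> 0" by (simp add: \<sigma>_eq_0_iff)
        moreover have "fls_subdegree (\<sigma> (nbhds p) (w q)) < int n"
          using M pq by (force simp: n_def)
        ultimately show ?thesis
          using red reduces_to_power_divide[of "\<sigma> (nbhds p) (s q)" "\<sigma> (nbhds p) (w q)" "w p" n] sp \<open>w p = 0\<close>
          by simp
      qed
    qed
    then show "\<sigma> (nbhds p) (s q ^ n / w q) \<leadsto> s p ^ n / w p"
      by (simp add: \<sigma>_divide \<sigma>_power)
  qed
  moreover have "s p ^ n = w p * (s p ^ n / w p)" for p
  proof (cases "w p = 0")
    case True
    then have "s p = 0" using supp regular_outside[OF s] by blast
    then show ?thesis using True by (simp add: n_def)
  qed simp
  then have "(\<lambda>p. s p ^ n) = (\<lambda>p. w p * (s p ^ n / w p))" by (rule ext)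
  moreover have "n > 0" by (simp add: n_def)
  ultimately show thesis by (intro that[of n "\<lambda>p. s p ^ n / w p"])
qed

text \<open>
  Otherwise compactness yields a point \<open>q\<close> with \<open>g q = 0\<close> that specializes to \<open>p\<close>, and then \<open>g p = 0\<close>.
\<close>

lemma support_open:
  assumes g: "g \<in> regular" and p: "p \<in> points" "g p \<noteq> 0"
  shows "\<exists>T. finite T \<and> T \<subseteq> nbhds p \<and> (\<forall>q\<in>points. T \<subseteq> nbhds q \<longrightarrow> g q \<noteq> 0)"
proof (rule ccontr)
  assume contra: "\<not> ?thesis"
  from regular_finite[OF g] obtain S where S: "finite S" "S \<subseteq> \<B>"
    "\<forall>p\<in>points. \<forall>q\<in>points. nbhds p \<inter> S = nbhds q \<inter> S \<longrightarrow> g p = g q"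
    by (elim exE conjE)
  have "\<exists>q\<in>points. nbhds p \<subseteq> nbhds q \<and> {} \<inter> nbhds q = {} \<and> g q = 0"
  proof (rule patch_compact[where S = S])
    show "g q = 0" if "p \<in> points" "q \<in> points" "nbhds p \<inter> S = nbhds q \<inter> S" "g p = 0" for p q
      using S(3)[rule_format, OF that(1-3)] that(4) by simp
    show "\<exists>q\<in>points. T \<subseteq> nbhds q \<and> W \<inter> nbhds q = {} \<and> g q = 0"
      if "finite T" "T \<subseteq> nbhds p" "finite W" "W \<subseteq> {}" for T W
    proof -
      have "\<not> (\<forall>q\<in>points. T \<subseteq> nbhds q \<longrightarrow> g q \<noteq> 0)"
        using contra[unfolded not_ex, THEN spec, of T] that(1,2) by simp
      moreover have "W = {}" using that(4) by simp
      ultimately show ?thesis by simp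
    qed
  qed (use S(1,2) nbhds_subset in auto)
  then obtain q where q: "q \<in> points" "nbhds p \<subseteq> nbhds q" "g q = 0" by blast
  from regular_reduce[OF g p(1) q(1,2)] have "g p = 0"
    using q(3) by (simp add: \<sigma>_0 reduces_to_0_unique)
  with p show False by simp
qed

text \<open>
  The dual statement: otherwise there is a specialization \<open>q\<close> of \<open>p\<close> with \<open>g q \<noteq> 0\<close>, although
  \<open>g p = 0\<close>.
\<close>

lemma support_covered:
  assumes g: "g \<in> regular" and p: "p \<in> points" "g p = 0"
  shows "\<exists>W. finite W \<and> W \<subseteq> \<B> - nbhds p \<and> (\<forall>q\<in>points. g q \<noteq> 0 \<longrightarrow> W \<inter> nbhds q \<noteq> {})"
proof (rule ccontr)
  assume contra: "\<not> ?thesis"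
  from regular_finite[OF g] obtain S where S: "finite S" "S \<subseteq> \<B>"
    "\<forall>p\<in>points. \<forall>q\<in>points. nbhds p \<inter> S = nbhds q \<inter> S \<longrightarrow> g p = g q"
    by (elim exE conjE)
  have "\<exists>q\<in>points. {} \<subseteq> nbhds q \<and> (\<B> - nbhds p) \<inter> nbhds q = {} \<and> g q \<noteq> 0"
  proof (rule patch_compact[where S = S])
    show "g q \<noteq> 0" if "p \<in> points" "q \<in> points" "nbhds p \<inter> S = nbhds q \<inter> S" "g p \<noteq> 0" for p q
      using S(3)[rule_format, OF that(1-3)] that(4) by simp
    show "\<exists>q\<in>points. T \<subseteq> nbhds q \<and> W \<inter> nbhds q = {} \<and> g q \<noteq> 0"
      if "finite T" "T \<subseteq> {}" "finite W" "W \<subseteq> \<B> - nbhds p" for T W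
    proof -
      have "\<not> (\<forall>q\<in>points. g q \<noteq> 0 \<longrightarrow> W \<inter> nbhds q \<noteq> {})"
        using contra[unfolded not_ex, THEN spec, of W] that(3,4) by simp
      moreover have "T = {}" using that(2) by simp
      ultimately show ?thesis by auto
    qed
  qed (use S(1,2) in auto)
  then obtain q where q: "q \<in> points" "(\<B> - nbhds p) \<inter> nbhds q = {}" "g q \<noteq> 0" by blast
  then have "nbhds q \<subseteq> nbhds p" using nbhds_subset[of q] by blast
  from regular_reduce[OF g q(1) p(1) this] have "g q = 0"
    using p(2) by (simp add: \<sigma>_0 reduces_to_0_unique)
  with q show False by simp
qed

section \<open>Prime ideals of the ring of regular functions\<close>

definition function_ring :: "('p \<Rightarrow> 'k) ring" where
  "function_ring = \<lparr>carrier = regular, monoid.mult = (\<lambda>g h p. g p * h p),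
     one = (\<lambda>p. if p \<in> points then 1 else 0), zero = (\<lambda>p. 0), add = (\<lambda>g h p. g p + h p)\<rparr>"

lemma function_ring_simps [simp]:
  "carrier function_ring = regular"
  "monoid.mult function_ring g h = (\<lambda>p. g p * h p)"
  "one function_ring = (\<lambda>p. if p \<in> points then 1 else 0)"
  "zero function_ring = (\<lambda>p. 0)"
  "add function_ring g h = (\<lambda>p. g p + h p)"
  by (simp_all add: function_ring_def)

lemma cring_function_ring: "cring function_ring"
proof (rule cringI)
  show "abelian_group function_ring"
  proof (rule abelian_groupI)
    show "\<exists>h\<in>carrier function_ring. h \<oplus>\<^bsub>function_ring\<^esub> g = \<zero>\<^bsub>function_ring\<^esub>"
      if "g \<in> carrier function_ring" for g
      using that by (intro bexI[of _ "\<lambda>p. - g p"]) (auto simp: regular_minus)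
  qed (auto simp: regular_add regular_0 add_ac)
  show "Group.comm_monoid function_ring"
    by (rule comm_monoidI) (auto simp: regular_mult regular_1 mult_ac regular_outside fun_eq_iff)
qed (auto simp: distrib_right)

lemma primeideal_point:
  assumes p: "p \<in> points"
  shows "primeideal {g \<in> regular. g p = 0} function_ring"
proof -
  interpret cring function_ring by (rule cring_function_ring)
  have "subgroup {g \<in> regular. g p = 0} (add_monoid function_ring)"
  proof (rule add.subgroupI)
    fix g assume g: "g \<in> {g \<in> regular. g p = 0}"
    have "\<ominus>\<^bsub>function_ring\<^esub> g = (\<lambda>p. - g p)"
      by (rule minus_equality) (use g in \<open>auto simp: regular_minus\<close>)
    then show "\<ominus>\<^bsub>function_ring\<^esub> g \<in> {g \<in> regular. g p = 0}"
      using g by (simp add: regular_minus)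
  qed (use regular_0 in \<open>auto simp: regular_add\<close>)
  then have "ideal {g \<in> regular. g p = 0} function_ring"
    by (intro idealI ring_axioms) (auto simp: regular_mult)
  then show ?thesis
  proof (rule primeidealI[OF _ cring_function_ring])
    have "(\<lambda>p. if p \<in> points then 1 else 0) \<notin> {g \<in> regular. g p = 0}" using p by simp
    then show "carrier function_ring \<noteq> {g \<in> regular. g p = 0}"
      using regular_1 by (metis function_ring_simps(1))
  qed auto
qed

lemma prime_power_mem:
  assumes P: "primeideal P function_ring" and g: "g \<in> regular" and n: "n > 0" "(\<lambda>p. g p ^ n) \<in> P"
  shows "g \<in> P"
  using n
proof (induction n rule: nat_induct_non_zero)
  case (Suc n)
  then have "g \<otimes>\<^bsub>function_ring\<^esub> (\<lambda>p. g p ^ n) \<in> P" by simp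
  then have "g \<in> P \<or> (\<lambda>p. g p ^ n) \<in> P"
    using g Suc.hyps regular_power by (intro primeideal.I_prime[OF P]) auto
  then show ?case using Suc.IH by blast
qed simp

text \<open>
  For prime ideals, divisibility up to powers turns inclusion of supports into membership.
\<close>

lemma prime_support:
  assumes P: "primeideal P function_ring" and s: "s \<in> regular" and w: "w \<in> P"
    and supp: "\<And>p. p \<in> points \<Longrightarrow> w p = 0 \<Longrightarrow> s p = 0"
  shows "s \<in> P"
proof -
  interpret primeideal P function_ring by (rule P)
  have "w \<in> regular" using a_subset w by auto
  from power_divisible[OF s this supp] obtain n h where
    nh: "n > 0" "h \<in> regular" "(\<lambda>p. s p ^ n) = (\<lambda>p. w p * h p)" .
  have "w \<otimes>\<^bsub>function_ring\<^esub> h \<in> P" using w nh(2) by (intro I_r_closed) simp_all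
  then show ?thesis using nh by (intro prime_power_mem[OF P s nh(1)]) simp
qed

text \<open>
  Regular functions whose supports are a finite union and a finite intersection of subbasic sets.
  The former lies in every ideal that contains the coordinates of its sets, and a prime ideal that
  contains the latter contains one of these coordinates.
\<close>

definition sum_function :: "'p set set \<Rightarrow> 'p \<Rightarrow> 'k" where
  "sum_function W p = (\<Sum>B\<in>W. coordinate B p)"

lemma sum_function_eq_0D:
  assumes "finite W" "W \<subseteq> \<B>" "p \<in> points" "sum_function W p = 0" "B \<in> W"
  shows "p \<notin> B"
proof
  assume "p \<in> B"
  have "sum_function W p = (\<Sum>B\<in>W \<inter> nbhds p. x B)"
    unfolding sum_function_def
    by (rule sum.mono_neutral_cong_right) (use assms in \<open>auto simp: coordinate_def nbhds_def\<close>)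
  moreover have "W \<inter> nbhds p \<noteq> {}" using assms \<open>p \<in> B\<close> by (auto simp: nbhds_def)
  ultimately show False using sum_x_nonzero[of "W \<inter> nbhds p"] assms by simp
qed

lemma sum_function_in_ideal:
  assumes "ideal P function_ring" "finite W" "\<And>B. B \<in> W \<Longrightarrow> coordinate B \<in> P"
  shows "sum_function W \<in> P"
proof -
  interpret ideal P function_ring by (rule assms)
  have "(\<lambda>p. \<Sum>B\<in>W. coordinate B p) \<in> P"
    using assms(2,3)
  proof (induction W rule: finite_induct)
    case empty
    then show ?case using additive_subgroup.zero_closed[OF is_additive_subgroup] by simp
  next
    case (insert B W)
    then have "coordinate B \<oplus>\<^bsub>function_ring\<^esub> (\<lambda>p. \<Sum>B\<in>W. coordinate B p) \<in> P"
      by (intro additive_subgroup.a_closed[OF is_additive_subgroup]) auto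
    then show ?case using insert by simp
  qed
  then show ?thesis by (simp add: sum_function_def[abs_def])
qed

definition prod_function :: "'p set set \<Rightarrow> 'p \<Rightarrow> 'k" where
  "prod_function T p = (if p \<in> points then \<Prod>B\<in>T. coordinate B p else 0)"

lemma prod_function_eq_0:
  assumes "finite T" "p \<in> points"
  shows "prod_function T p = 0 \<longleftrightarrow> (\<exists>B\<in>T. p \<notin> B)"
  using assms by (auto simp: prod_function_def coordinate_eq_0_iff)

lemma prod_function_regular:
  assumes "finite T" "T \<subseteq> \<B>"
  shows "prod_function T \<in> regular"
  using assms
proof (induction T rule: finite_induct)
  case empty
  then show ?case using regular_1 by (simp add: prod_function_def[abs_def] cong: if_cong)
next
  case (insert B T)
  then have "prod_function (insert B T) = (\<lambda>p. coordinate B p * prod_function T p)"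
    by (auto simp: prod_function_def)
  then show ?case using insert by (simp add: regular_mult coordinate_regular)
qed

lemma prod_function_prime:
  assumes P: "primeideal P function_ring" and "finite T" "T \<subseteq> \<B>" "prod_function T \<in> P"
  shows "\<exists>B\<in>T. coordinate B \<in> P"
  using assms(2-4)
proof (induction T rule: finite_induct)
  case empty
  interpret primeideal P function_ring by (rule P)
  have "\<one>\<^bsub>function_ring\<^esub> \<in> P" using empty by (simp add: prod_function_def[abs_def] cong: if_cong)
  then have "carrier function_ring = P" by (rule one_imp_carrier[symmetric])
  then show ?case using I_notcarr by blast
next
  case (insert B T)
  then have "prod_function (insert B T) = coordinate B \<otimes>\<^bsub>function_ring\<^esub> prod_function T"
    by (auto simp: prod_function_def)
  then have "coordinate B \<in> P \<or> prod_function T \<in> P"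
    using insert.prems insert.hyps
    by (intro primeideal.I_prime[OF P]) (auto simp: coordinate_regular prod_function_regular)
  then show ?case using insert by blast
qed

text \<open>
  The coordinates outside \<open>P\<close> determine the point. If no point had the pattern of \<open>J\<close> on a finite
  set \<open>S\<close>, then the intersection of \<open>S \<inter> J\<close> would be contained in the union of \<open>S - J\<close>; by
  \<open>prime_support\<close> the product of the coordinates of \<open>S \<inter> J\<close> would belong to \<open>P\<close>, although none of its
  factors does. Once the point \<open>p\<close> is found, membership of \<open>g\<close> in \<open>P\<close> is decided by comparing the
  support of \<open>g\<close> with finite unions of sets that avoid \<open>p\<close> or finite intersections of sets that
  contain \<open>p\<close>.
\<close>

lemma primeideal_is_point:
  assumes P: "primeideal P function_ring"
  shows "\<exists>p\<in>points. P = {g \<in> regular. g p = 0}"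
proof -
  interpret primeideal P function_ring by (rule P)
  have P_sub: "P \<subseteq> regular" using a_subset by auto
  define J where "J = {B \<in> \<B>. coordinate B \<notin> P}"
  have "\<exists>p\<in>points. nbhds p = J"
  proof (rule closed)
    show "J \<subseteq> \<B>" by (auto simp: J_def)
    fix S assume S: "finite S" "S \<subseteq> \<B>"
    show "\<exists>p\<in>points. nbhds p \<inter> S = J \<inter> S"
    proof (rule ccontr)
      assume contra: "\<not> ?thesis"
      have fin: "finite (S \<inter> J)" "finite (S - J)" "S \<inter> J \<subseteq> \<B>" "S - J \<subseteq> \<B>" using S by auto
      have "prod_function (S \<inter> J) \<in> P"
      proof (rule prime_support[OF P prod_function_regular])
        show "sum_function (S - J) \<in> P"
          using S fin by (intro sum_function_in_ideal is_ideal) (auto simp: J_def)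
        fix p assume p: "p \<in> points" "sum_function (S - J) p = 0"
        show "prod_function (S \<inter> J) p = 0"
        proof (rule ccontr)
          assume "prod_function (S \<inter> J) p \<noteq> 0"
          then have "\<forall>B\<in>S \<inter> J. p \<in> B" using prod_function_eq_0[OF fin(1) p(1)] by blast
          moreover have "\<forall>B\<in>S - J. p \<notin> B" using sum_function_eq_0D[OF fin(2,4) p] by blast
          ultimately have "nbhds p \<inter> S = J \<inter> S" using S(2) by (auto simp: nbhds_def)
          with contra p(1) show False by blast
        qed
      qed (use fin in auto)
      from prod_function_prime[OF P fin(1,3) this] show False by (auto simp: J_def)
    qed
  qed
  then obtain p where p: "p \<in> points" "nbhds p = J" by blast
  have "g \<in> P \<longleftrightarrow> g p = 0" if g: "g \<in> regular" for g
  proof (cases "g p = 0")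
    case True
    from support_covered[OF g p(1) True] obtain W where W: "finite W" "W \<subseteq> \<B> - nbhds p"
      and W_supp: "\<forall>q\<in>points. g q \<noteq> 0 \<longrightarrow> W \<inter> nbhds q \<noteq> {}" by (elim exE conjE)
    have "g \<in> P"
    proof (rule prime_support[OF P g])
      show "sum_function W \<in> P"
        using W by (intro sum_function_in_ideal is_ideal) (auto simp: J_def p(2))
      fix q assume q: "q \<in> points" "sum_function W q = 0"
      have "W \<subseteq> \<B>" using W(2) by blast
      then have "W \<inter> nbhds q = {}" using sum_function_eq_0D[OF W(1) _ q] by (auto simp: nbhds_def)
      then show "g q = 0" using W_supp q(1) by blast
    qed
    with True show ?thesis by simp
  next
    case False
    from support_open[OF g p(1) False] obtain T where T: "finite T" "T \<subseteq> nbhds p"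
      and T_supp: "\<forall>q\<in>points. T \<subseteq> nbhds q \<longrightarrow> g q \<noteq> 0" by (elim exE conjE)
    have T_B: "T \<subseteq> \<B>" using T(2) nbhds_subset by blast
    have "g \<notin> P"
    proof
      assume "g \<in> P"
      have "prod_function T \<in> P"
      proof (rule prime_support[OF P prod_function_regular \<open>g \<in> P\<close>])
        fix q assume q: "q \<in> points" "g q = 0"
        then have "\<not> T \<subseteq> nbhds q" using T_supp by blast
        then show "prod_function T q = 0"
          using T_B q(1) T(1) by (auto simp: prod_function_eq_0 nbhds_def)
      qed (use T T_B in auto)
      from prod_function_prime[OF P T(1) T_B this] obtain B where "B \<in> T" "coordinate B \<in> P" by blast
      then show False using T(2) p(2) by (auto simp: J_def)
    qed
    with False show ?thesis by simp
  qed
  with P_sub have "P = {g \<in> regular. g p = 0}" by blast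
  with p show ?thesis by blast
qed

lemma homeomorphic_Spec_function_ring:
  "(topology_generated_by \<B>) homeomorphic_space Zariski_Spec function_ring"
proof -
  define \<phi> where "\<phi> p = {g \<in> regular. g p = 0}" for p
  define \<psi> where "\<psi> = inv_into points \<phi>"
  let ?X = "topology_generated_by \<B>" and ?Y = "Zariski_Spec function_ring"
  have X: "topspace ?X = points" by (simp add: points_def)
  have Spec: "Spec function_ring = \<phi> ` points"
    using primeideal_point primeideal_is_point by (auto simp: Spec_def \<phi>_def)
  have inj: "inj_on \<phi> points"
  proof (rule inj_onI)
    fix p q assume pq: "p \<in> points" "q \<in> points" "\<phi> p = \<phi> q"
    have "p \<in> B \<longleftrightarrow> q \<in> B" if "B \<in> \<B>" for B
    proof -
      have "coordinate B \<in> \<phi> p \<longleftrightarrow> coordinate B \<in> \<phi> q" using pq by simp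
      then show ?thesis using pq that by (simp add: \<phi>_def coordinate_regular coordinate_eq_0_iff)
    qed
    then have "nbhds p = nbhds q" by (auto simp: nbhds_def)
    then show "p = q" using separated pq by blast
  qed
  have "continuous_map ?X ?Y \<phi>"
    unfolding continuous_map
  proof (intro conjI allI impI)
    show "\<phi> ` topspace ?X \<subseteq> topspace ?Y"
      by (simp add: topspace_Zariski_Spec Spec X del: topology_generated_by_topspace)
    fix U assume "openin ?Y U"
    then obtain S where S: "S \<subseteq> regular"
      "U = Spec function_ring - {P \<in> Spec function_ring. S \<subseteq> P}"
      by (auto simp: openin_Zariski_Spec_iff)
    show "openin ?X {p \<in> topspace ?X. \<phi> p \<in> U}" unfolding X
    proof (subst openin_subopen, intro ballI)
      fix p assume "p \<in> {p \<in> points. \<phi> p \<in> U}"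
      then have p: "p \<in> points" "\<not> S \<subseteq> \<phi> p" by (auto simp: S(2))
      then obtain g where g: "g \<in> S" "g p \<noteq> 0" "g \<in> regular" using S(1) by (auto simp: \<phi>_def)
      from support_open[OF g(3) p(1) g(2)] obtain T where T: "finite T" "T \<subseteq> nbhds p"
        and T_supp: "\<forall>q\<in>points. T \<subseteq> nbhds q \<longrightarrow> g q \<noteq> 0" by (elim exE conjE)
      have "openin ?X (points \<inter> \<Inter>T)"
        using T(1,2)
      proof (induction T rule: finite_induct)
        case empty
        show ?case using openin_topspace[of ?X] unfolding X by simp
      next
        case (insert B T)
        then have "B \<in> \<B>" using nbhds_subset by blast
        then have "openin ?X B" by (rule topology_generated_by_Basis)
        then have "openin ?X (B \<inter> (points \<inter> \<Inter>T))" using insert by (intro openin_Int[of ?X B]) simp_all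
        moreover have "B \<inter> (points \<inter> \<Inter>T) = points \<inter> \<Inter>(insert B T)" by auto
        ultimately show ?case by simp
      qed
      moreover have "p \<in> points \<inter> \<Inter>T" using p T(2) by (auto simp: nbhds_def)
      moreover have "points \<inter> \<Inter>T \<subseteq> {p \<in> points. \<phi> p \<in> U}"
      proof
        fix q assume q: "q \<in> points \<inter> \<Inter>T"
        then have "g q \<noteq> 0" using T(2) by (intro T_supp[rule_format]) (auto simp: nbhds_def)
        then have "\<not> S \<subseteq> \<phi> q" using g(1) by (auto simp: \<phi>_def)
        then show "q \<in> {p \<in> points. \<phi> p \<in> U}" using q by (simp add: S(2) Spec)
      qed
      ultimately show "\<exists>V. openin ?X V \<and> p \<in> V \<and> V \<subseteq> {p \<in> points. \<phi> p \<in> U}" by blast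
    qed
  qed
  moreover have "continuous_map ?Y ?X \<psi>"
  proof (rule continuous_on_generated_topo)
    show "\<psi> ` topspace ?Y \<subseteq> \<Union>\<B>"
      using inj by (auto simp: topspace_Zariski_Spec Spec \<psi>_def points_def[symmetric])
    fix B assume B: "B \<in> \<B>"
    have "\<psi> -` B \<inter> topspace ?Y = Spec function_ring - {P \<in> Spec function_ring. {coordinate B} \<subseteq> P}"
    proof -
      have "\<psi> (\<phi> p) = p" if "p \<in> points" for p using inj that by (simp add: \<psi>_def)
      moreover have "coordinate B \<in> \<phi> p \<longleftrightarrow> p \<notin> B" if "p \<in> points" for p
        using B that by (simp add: \<phi>_def coordinate_regular coordinate_eq_0_iff)
      ultimately show ?thesis unfolding topspace_Zariski_Spec Spec by auto
    qed
    then show "openin ?Y (\<psi> -` B \<inter> topspace ?Y)"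
      using B coordinate_regular unfolding openin_Zariski_Spec_iff by (intro exI[of _ "{coordinate B}"]) simp
  qed
  ultimately have "homeomorphic_maps ?X ?Y \<phi> \<psi>"
    using inj unfolding homeomorphic_maps_def X topspace_Zariski_Spec Spec \<psi>_def by auto
  then show ?thesis by (auto simp: homeomorphic_space_def)
qed

end

section \<open>A criterion for spectral spaces\<close>

lemma ex_inj_pair:
  assumes "infinite (UNIV :: 'a set)"
  shows "\<exists>f :: 'a \<times> 'a \<Rightarrow> 'a. inj f"
proof -
  have "\<exists>f. bij_betw f ((UNIV :: 'a set) \<times> (UNIV :: 'a set)) (UNIV :: 'a set)"
    unfolding card_of_ordIso by (rule card_of_Times_same_infinite[OF assms])
  then show ?thesis by (auto simp: bij_betw_def)
qed

text \<open>
  A list is encoded by iterated pairing; its length has to be recorded because the code of the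
  empty list, an arbitrary value, may also be the code of other lists.
\<close>

lemma ex_inj_list:
  assumes inf: "infinite (UNIV :: 'a set)"
  shows "\<exists>f :: 'a list \<Rightarrow> 'a. inj f"
proof -
  obtain pair :: "'a \<times> 'a \<Rightarrow> 'a" where pair: "inj pair" using ex_inj_pair[OF inf] by blast
  obtain num :: "nat \<Rightarrow> 'a" where num: "inj num"
    using inf by (meson infinite_countable_subset)
  define enc where "enc xs = foldr (\<lambda>x y. pair (x, y)) xs undefined" for xs
  have enc: "xs = ys" if "length xs = length ys" "enc xs = enc ys" for xs ys
    using that by (induction rule: list_induct2) (auto simp: enc_def dest!: injD[OF pair])
  have "inj (\<lambda>xs. pair (num (length xs), enc xs))"
    by (rule injI) (auto dest!: injD[OF pair] injD[OF num] intro: enc)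
  then show ?thesis by blast
qed

lemma ex_inj_poly_mapping:
  fixes f :: "'m \<Rightarrow> 'a" and g :: "'c::zero \<Rightarrow> 'a"
  assumes inf: "infinite (UNIV :: 'a set)" and f: "inj f" and g: "inj g"
  shows "\<exists>h :: ('m \<Rightarrow>\<^sub>0 'c) \<Rightarrow> 'a. inj h"
proof -
  obtain pair :: "'a \<times> 'a \<Rightarrow> 'a" where pair: "inj pair" using ex_inj_pair[OF inf] by blast
  obtain list :: "'a list \<Rightarrow> 'a" where list: "inj list" using ex_inj_list[OF inf] by blast
  define graph where "graph p = (\<lambda>m. pair (f m, g (Poly_Mapping.lookup p m))) ` Poly_Mapping.keys p" for p :: "'m \<Rightarrow>\<^sub>0 'c"
  have "inj graph"
  proof (rule injI)
    have *: "Poly_Mapping.lookup q m = Poly_Mapping.lookup p m"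
      if "graph p = graph q" "m \<in> Poly_Mapping.keys p" for p q m
    proof -
      have "pair (f m, g (Poly_Mapping.lookup p m)) \<in> graph q"
        using that(2) unfolding that(1)[symmetric] by (simp add: graph_def)
      then obtain m' where "pair (f m, g (Poly_Mapping.lookup p m)) = pair (f m', g (Poly_Mapping.lookup q m'))"
        unfolding graph_def by (rule imageE)
      from injD[OF pair this] have "f m = f m'" "g (Poly_Mapping.lookup p m) = g (Poly_Mapping.lookup q m')"
        by simp_all
      from injD[OF f this(1)] injD[OF g this(2)] show ?thesis by simp
    qed
    fix p q assume "graph p = graph q"
    then show "p = q"
      using *[of p q] *[of q p] by (intro poly_mapping_eqI) (metis in_keys_iff)
  qed
  moreover have "finite (graph p)" for p by (simp add: graph_def)
  then have "\<exists>xs. set xs = graph p" for p by (simp add: finite_list)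
  then obtain enum where "set (enum p) = graph p" for p by metis
  ultimately have "inj enum" by (metis injD injI)
  then have "inj (list \<circ> enum)" using list by (rule inj_compose[rotated])
  then show ?thesis by blast
qed

lemma ex_inj_fract:
  fixes f :: "'b::idom \<Rightarrow> 'a"
  assumes inf: "infinite (UNIV :: 'a set)" and f: "inj f"
  shows "\<exists>h :: 'b fract \<Rightarrow> 'a. inj h"
proof -
  obtain pair :: "'a \<times> 'a \<Rightarrow> 'a" where pair: "inj pair" using ex_inj_pair[OF inf] by blast
  have "\<exists>ab. z = Fraction_Field.Fract (fst ab) (snd ab)" for z :: "'b fract"
    by (cases z) auto
  then obtain rep where rep: "z = Fraction_Field.Fract (fst (rep z)) (snd (rep z))" for z :: "'b fract"
    by metis
  have "inj (\<lambda>z. pair (f (fst (rep z)), f (snd (rep z))))"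
    by (rule injI) (auto dest!: injD[OF pair] injD[OF f], metis rep)
  then show ?thesis by blast
qed

lemma ex_inj_ratfun:
  assumes inf: "infinite (UNIV :: 'a set)" and f: "inj (f :: 'v::linorder \<Rightarrow> 'a)"
  shows "\<exists>h :: 'v ratfun \<Rightarrow> 'a. inj h"
proof -
  obtain num :: "nat \<Rightarrow> 'a" where num: "inj num"
    using inf by (meson infinite_countable_subset)
  obtain mon :: "('v \<Rightarrow>\<^sub>0 nat) \<Rightarrow> 'a" where mon: "inj mon"
    using ex_inj_poly_mapping[OF inf f num] by blast
  have "inj (num \<circ> (to_nat :: int \<Rightarrow> nat))"
    using num by (intro inj_compose) simp_all
  then obtain pol :: "'v int_mpoly \<Rightarrow> 'a" where "inj pol"
    using ex_inj_poly_mapping[OF inf mon] by blast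
  then show ?thesis by (rule ex_inj_fract[OF inf])
qed

text \<open>
  The ring of regular functions has the right spectrum. Its elements are functions from points to a
  field that injects into the infinite type \<open>nat \<times> 'x set\<close>; the graph of such a function is
  encoded as a subset of this type.
\<close>

theorem spectral_space_patch_closed:
  fixes \<B> :: "'x set set"
  assumes separated: "\<And>p q. p \<in> \<Union>\<B> \<Longrightarrow> q \<in> \<Union>\<B> \<Longrightarrow> {B \<in> \<B>. p \<in> B} = {B \<in> \<B>. q \<in> B} \<Longrightarrow> p = q"
    and closed: "\<And>J. J \<subseteq> \<B> \<Longrightarrow>
      (\<And>S. finite S \<Longrightarrow> S \<subseteq> \<B> \<Longrightarrow> \<exists>p\<in>\<Union>\<B>. {B \<in> \<B>. p \<in> B} \<inter> S = J \<inter> S) \<Longrightarrow>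
      \<exists>p\<in>\<Union>\<B>. {B \<in> \<B>. p \<in> B} = J"
  shows "spectral_space (topology_generated_by \<B>)"
proof -
  interpret field: weighted_field "\<lambda>B :: 'x set. var (Abs_wellordered B)" "\<lambda>F. scale (Abs_wellordered ` F)"
    by (rule weighted_field_ratfun)
  interpret spectral_subbase \<B> "\<Union>\<B>" "\<lambda>p. {B \<in> \<B>. p \<in> B}"
      "\<lambda>B. var (Abs_wellordered B)" "\<lambda>F. scale (Abs_wellordered ` F)"
    by unfold_locales (fact separated, fact closed)
  have inf: "infinite (UNIV :: (nat \<times> 'x set) set)"
    by (simp add: finite_prod)
  obtain pair :: "(nat \<times> 'x set) \<times> (nat \<times> 'x set) \<Rightarrow> nat \<times> 'x set" where pair: "inj pair"
    using ex_inj_pair[OF inf] by blast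
  have "inj (\<lambda>i :: 'x set wellordered. (0 :: nat, Rep_wellordered i))"
    by (rule injI) (simp add: Rep_wellordered_inject)
  then obtain c :: "'x set wellordered ratfun \<Rightarrow> nat \<times> 'x set" where c: "inj c"
    using ex_inj_ratfun[OF inf] by blast
  define e where "e g = range (\<lambda>p. pair ((0, {p}), c (g p)))" for g :: "'x \<Rightarrow> 'x set wellordered ratfun"
  have "inj e"
  proof (rule injI, rule ext)
    fix g h p assume "e g = e h"
    then have "pair ((0, {p}), c (g p)) \<in> e h" by (auto simp: e_def)
    then show "g p = h p" by (auto simp: e_def dest!: injD[OF pair] injD[OF c])
  qed
  then have "inj_on e (carrier function_ring)" by (rule inj_on_subset) simp
  then show ?thesis
    by (rule spectral_spaceI[OF cring_function_ring homeomorphic_Spec_function_ring])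
qed

section \<open>Localizing systems and semistar operations\<close>

lemma ex_denominator: "\<exists>d. d \<noteq> 0 \<and> of_dom d * x \<in> range of_dom"
proof (cases x)
  case (Fract a b)
  then have "of_dom b * x = of_dom a" by (simp add: of_dom_def eq_fract)
  then show ?thesis using Fract by (intro exI[of _ b]) auto
qed

lemma submodule_mult: "submodule E \<Longrightarrow> d \<in> range of_dom \<Longrightarrow> x \<in> E \<Longrightarrow> d * x \<in> E"
  using fract.subspace_scale by blast

lemma module_hom_mult: "module_hom (\<lambda>d x. of_dom d * x) (\<lambda>d x. of_dom d * x) ((*) (z :: 'a::idom fract))"
  by unfold_locales (simp_all add: algebra_simps)

lemma submodule_image_mult: "submodule E \<Longrightarrow> submodule ((*) z ` E)"
  unfolding submodule_def by (rule module_hom.subspace_image[OF module_hom_mult])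

lemma generated_submodule_image_mult:
  "generated_submodule ((*) z ` S) = (*) z ` generated_submodule S"
  unfolding generated_submodule_def by (rule module_hom.span_image[OF module_hom_mult])

lemma generated_submodule_1: "generated_submodule {1} = range of_dom"
  unfolding fract.span_singleton by simp

lemma one_in_range: "1 \<in> range of_dom"
  by (metis of_dom_simps(4) rangeI)

lemma submodule_range: "submodule (range of_dom)"
  unfolding generated_submodule_1[symmetric] by (rule fract.subspace_span)

lemma nonzero_submodule: "submodule E \<Longrightarrow> E \<noteq> {0} \<longleftrightarrow> (\<exists>x\<in>E. x \<noteq> 0)"
  using fract.subspace_0 by blast

lemma Fbar_iff: "E \<in> Fbar \<longleftrightarrow> submodule E \<and> (\<exists>x\<in>E. x \<noteq> 0)"
  unfolding Fbar_def using nonzero_submodule by blast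

lemma Fbar_Int:
  assumes "E \<in> Fbar" "H \<in> Fbar"
  shows "E \<inter> H \<in> Fbar"
proof -
  have sub: "submodule E" "submodule H" using assms by (auto simp: Fbar_iff)
  obtain x y where xy: "x \<in> E" "x \<noteq> 0" "y \<in> H" "y \<noteq> 0" using assms by (auto simp: Fbar_iff)
  obtain c d where c: "c \<noteq> 0" "of_dom c * x \<in> range of_dom" and d: "d \<noteq> 0" "of_dom d * y \<in> range of_dom"
    using ex_denominator by metis
  define w where "w = (of_dom c * x) * (of_dom d * y)"
  have "w \<noteq> 0" using xy c d by (simp add: w_def of_dom_simps)
  moreover have "w = (of_dom d * y) * (of_dom c * x)" by (simp add: w_def)
  then have "w \<in> E" using sub xy d by (metis rangeI submodule_mult)
  moreover have "w \<in> H" unfolding w_def by (rule submodule_mult[OF sub(2) c(2) fract.subspace_scale[OF sub(2) xy(3)]])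
  ultimately show ?thesis using sub fract.subspace_inter by (auto simp: Fbar_iff)
qed

lemma Fbar_image_mult: "E \<in> Fbar \<Longrightarrow> z \<noteq> 0 \<Longrightarrow> (*) z ` E \<in> Fbar"
  by (auto simp: Fbar_iff submodule_image_mult)

definition fg_ideals :: "'a::idom fract set set" where
  "fg_ideals = {I. I \<subseteq> range of_dom \<and> I \<noteq> {0} \<and> (\<exists>S. finite S \<and> I = generated_submodule S)}"

lemma fg_ideals_Fbar: "I \<in> fg_ideals \<Longrightarrow> I \<in> Fbar"
  by (auto simp: fg_ideals_def Fbar_def)

lemma range_fg_ideals: "range of_dom \<in> fg_ideals"
proof -
  have "range of_dom \<noteq> {0}" using one_in_range by (metis one_neq_zero singletonD)
  moreover have "finite {1} \<and> range of_dom = generated_submodule {1}"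
    by (simp add: generated_submodule_1)
  ultimately show ?thesis unfolding fg_ideals_def by blast
qed

lemma image_mult_fg_frac_ideals:
  assumes I: "I \<in> fg_ideals" and x: "x \<noteq> 0"
  shows "(*) x ` I \<in> fg_frac_ideals"
proof -
  obtain d where d: "d \<noteq> 0" "of_dom d * x \<in> range of_dom" using ex_denominator by blast
  have "of_dom d * (x * i) \<in> range of_dom" if "i \<in> I" for i
  proof -
    have "i \<in> range of_dom" using that I by (auto simp: fg_ideals_def)
    then have "(of_dom d * x) * i \<in> range of_dom" by (rule submodule_mult[OF submodule_range d(2)])
    then show ?thesis by (simp add: mult.assoc)
  qed
  then have "fractional_ideal ((*) x ` I)"
    using d(1) Fbar_image_mult[OF fg_ideals_Fbar[OF I] x] by (auto simp: fractional_ideal_def Fbar_iff)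
  moreover have "(*) x ` I \<noteq> {0}"
    using Fbar_image_mult[OF fg_ideals_Fbar[OF I] x] by (simp add: Fbar_def)
  moreover obtain S where "finite S" "I = generated_submodule S" using I by (auto simp: fg_ideals_def)
  then have "finite ((*) x ` S)" "(*) x ` I = generated_submodule ((*) x ` S)"
    by (simp_all add: generated_submodule_image_mult)
  ultimately show ?thesis unfolding fg_frac_ideals_def by blast
qed

lemma fg_frac_ideals_Fbar: "F \<in> fg_frac_ideals \<Longrightarrow> F \<in> Fbar"
  by (auto simp: fg_frac_ideals_def fractional_ideal_def Fbar_def)

text \<open>
  The ideal \<open>\<Sum>\<^sub>a a H\<^sub>a\<close>, where \<open>a\<close> runs through a generating set \<open>S\<close>.
\<close>

definition combine :: "'a::idom fract set \<Rightarrow> ('a fract \<Rightarrow> 'a fract set) \<Rightarrow> 'a fract set" where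
  "combine S H = generated_submodule (\<Union>a\<in>S. (*) a ` H a)"

lemma combine_subset: "submodule E \<Longrightarrow> (\<And>a. a \<in> S \<Longrightarrow> (*) a ` H a \<subseteq> E) \<Longrightarrow> combine S H \<subseteq> E"
  unfolding combine_def by (rule fract.span_minimal) blast+

lemma image_subset_combine: "a \<in> S \<Longrightarrow> (*) a ` H a \<subseteq> combine S H"
  unfolding combine_def by (rule order.trans[OF _ fract.span_superset]) blast

lemma combine_fg_ideals:
  assumes S: "finite S" "generated_submodule S \<in> fg_ideals" and H: "\<And>a. a \<in> S \<Longrightarrow> H a \<in> fg_ideals"
  shows "combine S H \<in> fg_ideals"
proof -
  have "S \<subseteq> generated_submodule S" by (rule fract.span_superset)
  then have S_sub: "S \<subseteq> range of_dom" using S(2) unfolding fg_ideals_def by blast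
  have "combine S H \<subseteq> range of_dom"
  proof (rule combine_subset[OF submodule_range])
    fix a assume "a \<in> S"
    then have "H a \<subseteq> range of_dom" "a \<in> range of_dom" using H S_sub by (auto simp: fg_ideals_def)
    then show "(*) a ` H a \<subseteq> range of_dom" using submodule_mult[OF submodule_range] by blast
  qed
  moreover have "combine S H \<noteq> {0}"
  proof -
    have "\<not> S \<subseteq> {0}"
    proof
      assume "S \<subseteq> {0}"
      then have "generated_submodule S \<subseteq> {0}" by (rule fract.span_minimal) (rule fract.subspace_single_0)
      then show False using S(2) fract.span_zero[of S] by (auto simp: fg_ideals_def)
    qed
    then obtain a where a: "a \<in> S" "a \<noteq> 0" by blast
    obtain h where "h \<in> H a" "h \<noteq> 0" using fg_ideals_Fbar[OF H[OF a(1)]] by (auto simp: Fbar_iff)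
    then have "a * h \<in> combine S H" "a * h \<noteq> 0" using a image_subset_combine[OF a(1), of H] by auto
    then show ?thesis by blast
  qed
  moreover have "\<exists>T. finite T \<and> combine S H = generated_submodule T"
  proof -
    have "\<forall>a\<in>S. \<exists>T. finite T \<and> H a = generated_submodule T" using H by (auto simp: fg_ideals_def)
    from bchoice[OF this] obtain T where T: "\<forall>a\<in>S. finite (T a) \<and> H a = generated_submodule (T a)" ..
    have "combine S H = generated_submodule (\<Union>a\<in>S. (*) a ` T a)" (is "_ = generated_submodule ?U")
    proof
      have "(*) a ` H a \<subseteq> generated_submodule ?U" if "a \<in> S" for a
      proof -
        have "(*) a ` H a = generated_submodule ((*) a ` T a)"
          using T that by (simp add: generated_submodule_image_mult)
        also have "\<dots> \<subseteq> generated_submodule ?U" by (rule fract.span_mono) (use that in blast)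
        finally show ?thesis .
      qed
      then show "combine S H \<subseteq> generated_submodule ?U" by (intro combine_subset fract.subspace_span)
      have "T a \<subseteq> H a" if "a \<in> S" for a using T that fract.span_superset by blast
      then show "generated_submodule ?U \<subseteq> combine S H"
        unfolding combine_def by (intro fract.span_mono) blast
    qed
    moreover have "finite ?U" using S(1) T by blast
    ultimately show ?thesis by blast
  qed
  ultimately show ?thesis unfolding fg_ideals_def by blast
qed

text \<open>
  The trace of a localizing system of finite type on the finitely generated ideals. In the last
  condition \<open>\<Sum>\<^sub>a a H\<^sub>a\<close> replaces the usual arbitrary ideal \<open>B\<close> for which \<open>(B : a)\<close> contains a member of the
  system for each generator \<open>a\<close> of a member. In this form every condition mentions finitely many ideals,
  which is what makes the conditions pass to limits.
\<close>

definition localizing :: "'a::idom fract set set \<Rightarrow> bool" where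
  "localizing J \<longleftrightarrow> J \<subseteq> fg_ideals \<and> range of_dom \<in> J \<and>
     (\<forall>I\<in>J. \<forall>I'\<in>fg_ideals. I \<subseteq> I' \<longrightarrow> I' \<in> J) \<and>
     (\<forall>S H. finite S \<and> generated_submodule S \<in> J \<and> (\<forall>a\<in>S. H a \<in> J) \<longrightarrow> combine S H \<in> J)"

lemma localizingD:
  assumes "localizing J"
  shows "I \<in> J \<Longrightarrow> I \<in> fg_ideals" "range of_dom \<in> J"
    "I \<in> J \<Longrightarrow> I' \<in> fg_ideals \<Longrightarrow> I \<subseteq> I' \<Longrightarrow> I' \<in> J"
    "finite S \<Longrightarrow> generated_submodule S \<in> J \<Longrightarrow> (\<And>a. a \<in> S \<Longrightarrow> H a \<in> J) \<Longrightarrow> combine S H \<in> J"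
  using assms unfolding localizing_def by blast+

text \<open>
  The product of two members is a member, and it is contained in both.
\<close>

lemma localizing_Int:
  assumes J: "localizing J" and I: "I \<in> J" "I' \<in> J"
  shows "\<exists>I''\<in>J. I'' \<subseteq> I \<inter> I'"
proof -
  have sub: "I \<subseteq> range of_dom" "I' \<subseteq> range of_dom" "submodule I" "submodule I'"
    using localizingD(1)[OF J] I by (auto simp: fg_ideals_def)
  obtain S where S: "finite S" "I = generated_submodule S"
    using localizingD(1)[OF J I(1)] by (auto simp: fg_ideals_def)
  have SI: "S \<subseteq> I" using S(2) fract.span_superset by blast
  have "combine S (\<lambda>_. I') \<in> J" using localizingD(4)[OF J S(1), of "\<lambda>_. I'"] S I by simp
  moreover have "a * h \<in> I" "a * h \<in> I'" if "a \<in> S" "h \<in> I'" for a h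
  proof -
    show "a * h \<in> I'" using submodule_mult[OF sub(4), of a h] that SI sub(1) by blast
    show "a * h \<in> I" using submodule_mult[OF sub(3), of h a] that SI sub(2) by (auto simp: mult.commute)
  qed
  then have "combine S (\<lambda>_. I') \<subseteq> I \<inter> I'"
    using sub(3,4) by (intro combine_subset fract.subspace_inter) auto
  ultimately show ?thesis by blast
qed

text \<open>
  The usual operation \<open>E \<mapsto> \<Union>{(E : I) | I \<in> J}\<close> of a localizing system. The sets \<open>(E : I)\<close> are directed by
  \<open>localizing_Int\<close>, so that their union is a module, and for the same reason the operation is stable;
  it is of finite type because \<open>x \<in> (E : I)\<close> involves only the finitely generated submodule \<open>x I\<close> of \<open>E\<close>.
\<close>

definition semistar_of :: "'a::idom fract set set \<Rightarrow> 'a fract set \<Rightarrow> 'a fract set" where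
  "semistar_of J E = (if E \<in> Fbar then {x. \<exists>I\<in>J. (*) x ` I \<subseteq> E} else undefined)"

context
  fixes J :: "'a::idom fract set set"
  assumes J: "localizing J"
begin

lemma mem_semistar_of: "E \<in> Fbar \<Longrightarrow> x \<in> semistar_of J E \<longleftrightarrow> (\<exists>I\<in>J. (*) x ` I \<subseteq> E)"
  by (simp add: semistar_of_def)

lemma semistar_of_extensive: "E \<in> Fbar \<Longrightarrow> E \<subseteq> semistar_of J E"
proof
  fix x assume E: "E \<in> Fbar" "x \<in> E"
  then have "(*) x ` range of_dom \<subseteq> E"
    using submodule_mult[of E _ x] by (auto simp: Fbar_iff mult.commute)
  then show "x \<in> semistar_of J E" using localizingD(2)[OF J] E by (auto simp: mem_semistar_of)
qed

lemma semistar_of_mono: "E \<in> Fbar \<Longrightarrow> F \<in> Fbar \<Longrightarrow> E \<subseteq> F \<Longrightarrow> semistar_of J E \<subseteq> semistar_of J F"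
  by (auto simp: mem_semistar_of) (meson order_trans)

lemma semistar_of_Fbar:
  assumes E: "E \<in> Fbar"
  shows "semistar_of J E \<in> Fbar"
proof -
  have sub: "submodule E" using E by (simp add: Fbar_iff)
  have "submodule (semistar_of J E)"
  proof (rule fract.subspaceI)
    show "0 \<in> semistar_of J E"
      using semistar_of_extensive[OF E] fract.subspace_0[OF sub] by blast
  next
    fix x y assume "x \<in> semistar_of J E" "y \<in> semistar_of J E"
    then obtain I I' where I: "I \<in> J" "(*) x ` I \<subseteq> E" "I' \<in> J" "(*) y ` I' \<subseteq> E"
      using E by (auto simp: mem_semistar_of)
    obtain I'' where I'': "I'' \<in> J" "I'' \<subseteq> I \<inter> I'" using localizing_Int[OF J I(1,3)] by blast
    have "(x + y) * i \<in> E" if "i \<in> I''" for i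
    proof -
      have "x * i \<in> E" "y * i \<in> E" using that I I'' by (auto simp: image_subset_iff)
      then show ?thesis using fract.subspace_add[OF sub] by (simp add: distrib_right)
    qed
    then show "x + y \<in> semistar_of J E" using E I''(1) by (auto simp: mem_semistar_of)
  next
    fix c x assume "x \<in> semistar_of J E"
    then obtain I where I: "I \<in> J" "(*) x ` I \<subseteq> E" using E by (auto simp: mem_semistar_of)
    have "of_dom c * x * i \<in> E" if "i \<in> I" for i
      using that I fract.subspace_scale[OF sub, of "x * i" c] by (auto simp: mult.assoc)
    then show "of_dom c * x \<in> semistar_of J E" using E I(1) by (auto simp: mem_semistar_of)
  qed
  then show ?thesis using semistar_of_extensive[OF E] E by (auto simp: Fbar_iff)
qed

lemma semistar_of_image_mult:
  assumes E: "E \<in> Fbar" and z: "z \<noteq> 0"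
  shows "semistar_of J ((*) z ` E) = (*) z ` semistar_of J E"
proof -
  have zE: "(*) z ` E \<in> Fbar" using Fbar_image_mult[OF E z] .
  have z_iff: "y \<in> (*) z ` A \<longleftrightarrow> inverse z * y \<in> A" for y A
    using z by (auto simp: image_iff mult.assoc[symmetric]) (metis mult.assoc mult_1_left right_inverse)
  have "y \<in> semistar_of J ((*) z ` E) \<longleftrightarrow> inverse z * y \<in> semistar_of J E" for y
    unfolding mem_semistar_of[OF E] mem_semistar_of[OF zE] image_subset_iff z_iff
    by (simp add: mult.assoc)
  then show ?thesis using z_iff by blast
qed

text \<open>
  If \<open>x I\<close> is contained in \<open>E\<^sup>\<star>\<close>, each generator \<open>a\<close> of \<open>I\<close> has an \<open>H\<^sub>a\<close> with \<open>x a H\<^sub>a \<subseteq> E\<close>, and these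
  combine to a single ideal.
\<close>

lemma semistar_of_idem:
  assumes E: "E \<in> Fbar"
  shows "semistar_of J (semistar_of J E) = semistar_of J E"
proof
  show "semistar_of J E \<subseteq> semistar_of J (semistar_of J E)"
    by (rule semistar_of_extensive[OF semistar_of_Fbar[OF E]])
  show "semistar_of J (semistar_of J E) \<subseteq> semistar_of J E"
  proof
    fix x assume "x \<in> semistar_of J (semistar_of J E)"
    then obtain I where I: "I \<in> J" "(*) x ` I \<subseteq> semistar_of J E"
      using semistar_of_Fbar[OF E] by (auto simp: mem_semistar_of)
    obtain S where S: "finite S" "I = generated_submodule S"
      using localizingD(1)[OF J I(1)] by (auto simp: fg_ideals_def)
    have "\<forall>a\<in>S. \<exists>I\<in>J. (*) (x * a) ` I \<subseteq> E"
    proof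
      fix a assume "a \<in> S"
      then have "x * a \<in> semistar_of J E" using I(2) S(2) fract.span_base by blast
      then show "\<exists>I\<in>J. (*) (x * a) ` I \<subseteq> E" using E by (simp add: mem_semistar_of)
    qed
    from bchoice[OF this[unfolded Bex_def]] obtain H where H: "\<forall>a\<in>S. H a \<in> J \<and> (*) (x * a) ` H a \<subseteq> E" ..
    have "(*) x ` combine S H = generated_submodule ((*) x ` (\<Union>a\<in>S. (*) a ` H a))"
      by (simp add: combine_def generated_submodule_image_mult)
    also have "\<dots> \<subseteq> E"
      using E H by (intro fract.span_minimal) (auto simp: Fbar_iff mult.assoc)
    finally have "(*) x ` combine S H \<subseteq> E" .
    moreover have "combine S H \<in> J" using localizingD(4)[OF J S(1), of H] S(2) I(1) H by blast
    ultimately show "x \<in> semistar_of J E" using E by (auto simp: mem_semistar_of)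
  qed
qed

lemma semistar_of_SStar: "semistar_of J \<in> SStar"
  unfolding SStar_def
proof (intro CollectI conjI allI impI ballI)
  show "semistar_of J \<in> Fbar \<rightarrow>\<^sub>E Fbar"
    using semistar_of_Fbar by (auto simp: semistar_of_def[of J])
qed (use semistar_of_image_mult semistar_of_mono semistar_of_extensive semistar_of_idem in \<open>simp_all\<close>)

lemma semistar_of_finite_type: "finite_type (semistar_of J)"
  unfolding finite_type_def
proof (intro ballI equalityI subsetI)
  fix E :: "'a fract set" and x assume E: "E \<in> Fbar" and x: "x \<in> semistar_of J E"
  show "x \<in> \<Union>{semistar_of J F |F. F \<subseteq> E \<and> F \<in> fg_frac_ideals}"
  proof (cases "x = 0")
    case True
    obtain y where y: "y \<in> E" "y \<noteq> 0" using E by (auto simp: Fbar_iff)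
    let ?F = "(*) y ` range of_dom"
    have F: "?F \<in> fg_frac_ideals" using image_mult_fg_frac_ideals[OF range_fg_ideals y(2)] .
    have "?F \<subseteq> E"
      using submodule_mult[of E _ y] E y(1) by (auto simp: Fbar_iff mult.commute)
    moreover have "x \<in> semistar_of J ?F"
      using semistar_of_Fbar[OF fg_frac_ideals_Fbar[OF F]] True fract.subspace_0 by (auto simp: Fbar_iff)
    ultimately show ?thesis using F by blast
  next
    case False
    obtain I where I: "I \<in> J" "(*) x ` I \<subseteq> E" using x E by (auto simp: mem_semistar_of)
    have F: "(*) x ` I \<in> fg_frac_ideals"
      using image_mult_fg_frac_ideals[OF localizingD(1)[OF J I(1)] False] .
    then have "x \<in> semistar_of J ((*) x ` I)"
      using I(1) fg_frac_ideals_Fbar[OF F] by (auto simp: mem_semistar_of)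
    then show ?thesis using F I(2) by blast
  qed
next
  fix E :: "'a fract set" and x
  assume E: "E \<in> Fbar" and "x \<in> \<Union>{semistar_of J F |F. F \<subseteq> E \<and> F \<in> fg_frac_ideals}"
  then show "x \<in> semistar_of J E" using semistar_of_mono fg_frac_ideals_Fbar by blast
qed

lemma semistar_of_stable: "stable (semistar_of J)"
  unfolding stable_def
proof (intro ballI equalityI subsetI)
  fix E H :: "'a fract set" and x assume EH: "E \<in> Fbar" "H \<in> Fbar"
  then have EH': "E \<inter> H \<in> Fbar" by (rule Fbar_Int)
  show "x \<in> semistar_of J E \<inter> semistar_of J H" if "x \<in> semistar_of J (E \<inter> H)"
    using that EH EH' semistar_of_mono[of "E \<inter> H"] by blast
  assume "x \<in> semistar_of J E \<inter> semistar_of J H"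
  then obtain I I' where I: "I \<in> J" "(*) x ` I \<subseteq> E" "I' \<in> J" "(*) x ` I' \<subseteq> H"
    using EH by (auto simp: mem_semistar_of)
  obtain I'' where "I'' \<in> J" "I'' \<subseteq> I \<inter> I'" using localizing_Int[OF J I(1,3)] by blast
  then show "x \<in> semistar_of J (E \<inter> H)"
    using I EH' by (auto simp: mem_semistar_of image_subset_iff intro!: bexI[of _ I''])
qed

lemma semistar_of_SStar_f_sp: "semistar_of J \<in> SStar_f_sp"
  by (simp add: SStar_f_sp_def semistar_of_SStar semistar_of_finite_type semistar_of_stable)

lemma one_mem_semistar_of:
  assumes "I \<in> fg_ideals"
  shows "1 \<in> semistar_of J I \<longleftrightarrow> I \<in> J"
proof -
  have "1 \<in> semistar_of J I \<longleftrightarrow> (\<exists>I'\<in>J. I' \<subseteq> I)"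
    using assms by (simp add: mem_semistar_of fg_ideals_Fbar)
  then show ?thesis using localizingD(3)[OF J _ assms] by blast
qed

end

lemma SStarD:
  assumes "st \<in> SStar" "E \<in> Fbar"
  shows "st E \<in> Fbar" "z \<noteq> 0 \<Longrightarrow> st ((*) z ` E) = (*) z ` st E"
    "F \<in> Fbar \<Longrightarrow> E \<subseteq> F \<Longrightarrow> st E \<subseteq> st F" "E \<subseteq> st E" "st (st E) = st E"
  using assms unfolding SStar_def by (auto dest: PiE_mem)

text \<open>
  Stability reduces the condition \<open>1 \<in> E\<^sup>\<star>\<close> to the ideal \<open>E \<inter> D\<close>, and finite type to a finitely generated
  ideal inside it.
\<close>

lemma ex_fg_ideal:
  assumes st: "st \<in> SStar_f_sp" and E: "E \<in> Fbar" "1 \<in> st E"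
  shows "\<exists>G\<in>fg_ideals. G \<subseteq> E \<and> 1 \<in> st G"
proof -
  have D: "range of_dom \<in> Fbar" by (rule fg_ideals_Fbar[OF range_fg_ideals])
  have "st \<in> SStar" "finite_type st" "stable st" using st by (auto simp: SStar_f_sp_def)
  then have "1 \<in> st (range of_dom)" using SStarD(4)[OF _ D] one_in_range by blast
  then have "1 \<in> st (E \<inter> range of_dom)" using \<open>stable st\<close> E D unfolding stable_def by blast
  then obtain F where F: "F \<subseteq> E \<inter> range of_dom" "F \<in> fg_frac_ideals" "1 \<in> st F"
    using \<open>finite_type st\<close> Fbar_Int[OF E(1) D] unfolding finite_type_def by blast
  then have "F \<in> fg_ideals" by (auto simp: fg_ideals_def fg_frac_ideals_def)
  then show ?thesis using F by blast
qed

text \<open>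
  For the last condition, \<open>a \<in> a H\<^sub>a\<^sup>\<star> = (a H\<^sub>a)\<^sup>\<star>\<close> shows that \<open>(\<Sum>\<^sub>a a H\<^sub>a)\<^sup>\<star>\<close> contains all generators \<open>a\<close>,
  hence the closure of the ideal that they generate.
\<close>

lemma localizing_SStar:
  assumes st: "st \<in> SStar"
  shows "localizing {I \<in> fg_ideals. 1 \<in> st I}"
  unfolding localizing_def
proof (intro conjI ballI allI impI)
  show "range of_dom \<in> {I \<in> fg_ideals. 1 \<in> st I}"
    using SStarD(4)[OF st fg_ideals_Fbar[OF range_fg_ideals]] one_in_range range_fg_ideals by blast
  show "I' \<in> {I \<in> fg_ideals. 1 \<in> st I}"
    if "I \<in> {I \<in> fg_ideals. 1 \<in> st I}" "I' \<in> fg_ideals" "I \<subseteq> I'" for I I'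
    using that SStarD(3)[OF st, of I I'] fg_ideals_Fbar by blast
  fix S H assume "finite S \<and> generated_submodule S \<in> {I \<in> fg_ideals. 1 \<in> st I} \<and>
    (\<forall>a\<in>S. H a \<in> {I \<in> fg_ideals. 1 \<in> st I})"
  then have S: "finite S" "generated_submodule S \<in> fg_ideals" "1 \<in> st (generated_submodule S)"
    and H: "\<And>a. a \<in> S \<Longrightarrow> H a \<in> fg_ideals \<and> 1 \<in> st (H a)" by auto
  let ?Q = "combine S H"
  have Q: "?Q \<in> fg_ideals" using combine_fg_ideals S H by blast
  have stQ: "st ?Q \<in> Fbar" "submodule (st ?Q)"
    using SStarD(1)[OF st fg_ideals_Fbar[OF Q]] by (auto simp: Fbar_iff)
  have "a \<in> st ?Q" if "a \<in> S" for a
  proof (cases "a = 0")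
    case True
    then show ?thesis using fract.subspace_0[OF stQ(2)] by simp
  next
    case False
    have Ha: "H a \<in> Fbar" using H[OF that] fg_ideals_Fbar by blast
    have "a * 1 \<in> (*) a ` st (H a)" using H[OF that] by blast
    also have "\<dots> = st ((*) a ` H a)" using SStarD(2)[OF st Ha False] by simp
    also have "\<dots> \<subseteq> st ?Q"
      using SStarD(3)[OF st Fbar_image_mult[OF Ha False] fg_ideals_Fbar[OF Q] image_subset_combine[OF that]] .
    finally show ?thesis by simp
  qed
  then have "generated_submodule S \<subseteq> st ?Q" using stQ(2) by (intro fract.span_minimal) auto
  then have "st (generated_submodule S) \<subseteq> st (st ?Q)"
    using SStarD(3)[OF st fg_ideals_Fbar[OF S(2)] stQ(1)] by blast
  then show "?Q \<in> {I \<in> fg_ideals. 1 \<in> st I}"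
    using SStarD(5)[OF st fg_ideals_Fbar[OF Q]] S(3) Q by auto
qed blast

text \<open>
  Scaling reduces \<open>x \<in> E\<^sup>\<star>\<close> to \<open>1 \<in> (E / x)\<^sup>\<star>\<close> for \<open>x \<noteq> 0\<close>, and \<open>ex_fg_ideal\<close> reduces this to
  finitely generated ideals.
\<close>

lemma SStar_f_sp_eqI:
  assumes st: "st \<in> SStar_f_sp" "st' \<in> SStar_f_sp"
    and eq: "\<And>I. I \<in> fg_ideals \<Longrightarrow> 1 \<in> st I \<longleftrightarrow> 1 \<in> st' I"
  shows "st = st'"
proof
  have S: "st \<in> SStar" "st' \<in> SStar" using st by (auto simp: SStar_f_sp_def)
  have mem: "1 \<in> s E \<longleftrightarrow> (\<exists>G\<in>fg_ideals. G \<subseteq> E \<and> 1 \<in> s G)" if "s \<in> SStar_f_sp" "E \<in> Fbar" for s E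
    using ex_fg_ideal[OF that] SStarD(3)[of s _ E] fg_ideals_Fbar that by (auto simp: SStar_f_sp_def)
  have one: "1 \<in> st E \<longleftrightarrow> 1 \<in> st' E" if "E \<in> Fbar" for E
    using mem[OF st(1) that] mem[OF st(2) that] eq by blast
  fix E
  show "st E = st' E"
  proof (cases "E \<in> Fbar")
    case False
    then show ?thesis using S by (auto simp: SStar_def PiE_def extensional_def)
  next
    case True
    have "x \<in> s E \<longleftrightarrow> 1 \<in> s ((*) (inverse x) ` E)" if "s \<in> SStar" "x \<noteq> 0" for s x
    proof -
      have "1 \<in> s ((*) (inverse x) ` E) \<longleftrightarrow> 1 \<in> (*) (inverse x) ` s E"
        using SStarD(2)[OF that(1) True, of "inverse x"] that(2) by simp
      also have "\<dots> \<longleftrightarrow> x \<in> s E"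
      proof
        assume "1 \<in> (*) (inverse x) ` s E"
        then obtain y where "y \<in> s E" "1 = inverse x * y" by blast
        moreover from this have "y = x" using that(2) by (metis inverse_unique inverse_inverse_eq)
        ultimately show "x \<in> s E" by simp
      next
        assume "x \<in> s E"
        then show "1 \<in> (*) (inverse x) ` s E" using that(2) by (intro image_eqI[of _ _ x]) simp_all
      qed
      finally show ?thesis ..
    qed
    then have "x \<in> st E \<longleftrightarrow> x \<in> st' E" if "x \<noteq> 0" for x
      using S that one[OF Fbar_image_mult[OF True, of "inverse x"]] by simp
    moreover have "0 \<in> st E" "0 \<in> st' E"
      using SStarD(1)[OF _ True] S fract.subspace_0 by (auto simp: Fbar_iff)
    ultimately show ?thesis by (metis subsetI subset_antisym)
  qed
qed

definition basic_open :: "'a::idom fract set \<Rightarrow> ('a fract set \<Rightarrow> 'a fract set) set" where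
  "basic_open I = {st \<in> SStar_f_sp. 1 \<in> st I}"

lemma Union_basic_open: "\<Union>(basic_open ` fg_ideals) = (SStar_f_sp :: ('a::idom fract set \<Rightarrow> _) set)"
proof
  show "SStar_f_sp \<subseteq> \<Union>(basic_open ` (fg_ideals :: 'a fract set set))"
  proof
    fix st :: "'a fract set \<Rightarrow> 'a fract set" assume st: "st \<in> SStar_f_sp"
    then have "1 \<in> st (range of_dom)"
      using SStarD(4)[OF _ fg_ideals_Fbar[OF range_fg_ideals]] one_in_range by (auto simp: SStar_f_sp_def)
    then show "st \<in> \<Union>(basic_open ` fg_ideals)" using st range_fg_ideals by (auto simp: basic_open_def)
  qed
qed (auto simp: basic_open_def)

text \<open>
  By \<open>ex_fg_ideal\<close>, the trace of a subbasic open set of \<^const>\<open>Zariski_SStar\<close> is the union of the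
  basic open sets of the finitely generated ideals contained in its module.
\<close>

lemma Zariski_SStar_f_sp:
  "subtopology Zariski_SStar SStar_f_sp = topology_generated_by (basic_open ` (fg_ideals :: 'a::idom fract set set))"
    (is "?X = ?Y")
proof -
  have X: "topspace ?X = SStar_f_sp"
    by (auto simp: topspace_Zariski_SStar SStar_f_sp_def)
  have Y: "topspace ?Y = SStar_f_sp" by (simp add: Union_basic_open)
  have open_V: "openin Zariski_SStar {st \<in> SStar. 1 \<in> st E}" if "E \<in> Fbar" for E :: "'a fract set"
    unfolding Zariski_SStar_def by (rule topology_generated_by_Basis) (use that in blast)
  have "continuous_map ?X ?Y id"
  proof (rule continuous_on_generated_topo)
    show "id ` topspace ?X \<subseteq> \<Union>(basic_open ` fg_ideals)" unfolding X Union_basic_open by simp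
    fix U assume "U \<in> basic_open ` (fg_ideals :: 'a fract set set)"
    then obtain I where I: "I \<in> fg_ideals" "U = basic_open I" by blast
    have "id -` U \<inter> topspace ?X = {st \<in> SStar. 1 \<in> st I} \<inter> SStar_f_sp"
      unfolding X I(2) by (auto simp: basic_open_def SStar_f_sp_def)
    then show "openin ?X (id -` U \<inter> topspace ?X)"
      using open_V[OF fg_ideals_Fbar[OF I(1)]] unfolding openin_subtopology by blast
  qed
  moreover have "continuous_map ?Y Zariski_SStar id"
    unfolding Zariski_SStar_def
  proof (rule continuous_on_generated_topo)
    show "id ` topspace ?Y \<subseteq> \<Union>{{st \<in> SStar. 1 \<in> st E} |E. E \<in> Fbar}"
      unfolding Y using topspace_Zariski_SStar[where 'a = 'a]
      by (auto simp: Zariski_SStar_def SStar_f_sp_def)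
    fix U :: "('a fract set \<Rightarrow> 'a fract set) set"
    assume "U \<in> {{st \<in> SStar. 1 \<in> st E} |E. E \<in> Fbar}"
    then obtain E where E: "E \<in> Fbar" "U = {st \<in> SStar. 1 \<in> st E}" by blast
    have "id -` U \<inter> topspace ?Y = \<Union>(basic_open ` {G \<in> fg_ideals. G \<subseteq> E})"
    proof
      show "id -` U \<inter> topspace ?Y \<subseteq> \<Union>(basic_open ` {G \<in> fg_ideals. G \<subseteq> E})"
        using ex_fg_ideal[OF _ E(1)] unfolding Y E(2) by (auto simp: basic_open_def)
      show "\<Union>(basic_open ` {G \<in> fg_ideals. G \<subseteq> E}) \<subseteq> id -` U \<inter> topspace ?Y"
        unfolding Y E(2) using SStarD(3)[OF _ _ E(1)] fg_ideals_Fbar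
        by (auto simp: basic_open_def SStar_f_sp_def)
    qed
    also have "openin ?Y \<dots>"
      by (rule openin_Union) (auto intro: topology_generated_by_Basis)
    finally show "openin ?Y (id -` U \<inter> topspace ?Y)" .
  qed
  then have "continuous_map ?Y ?X id"
    by (rule continuous_map_into_subtopology) (simp add: Y[unfolded topology_generated_by_topspace])
  moreover have "openin T' U"
    if "continuous_map T' T id" "openin T U" "topspace T = topspace T'" for T T' and U :: "('a fract set \<Rightarrow> 'a fract set) set"
  proof -
    have "{x \<in> topspace T'. id x \<in> U} = U" using openin_subset[OF that(2)] that(3) by auto
    then show ?thesis using openin_continuous_map_preimage[OF that(1,2)] by simp
  qed
  ultimately show ?thesis unfolding topology_eq using X Y by metis
qed

text \<open>
  Each axiom for \<open>J\<close> follows from the same axiom for an operation that agrees with \<open>J\<close> on the finitely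
  many ideals that the axiom mentions.
\<close>

lemma localizing_limit:
  assumes J: "J \<subseteq> (fg_ideals :: 'a::idom fract set set)"
    and fin: "\<And>S. finite S \<Longrightarrow> S \<subseteq> fg_ideals \<Longrightarrow>
       \<exists>st\<in>SStar_f_sp. \<forall>I\<in>S. 1 \<in> st I \<longleftrightarrow> I \<in> J"
  shows "localizing J"
proof -
  have approx: "\<exists>J'. localizing J' \<and> (\<forall>I\<in>S. I \<in> J' \<longleftrightarrow> I \<in> J)" if S: "finite S" "S \<subseteq> fg_ideals" for S
  proof -
    obtain st where "st \<in> SStar_f_sp" "\<forall>I\<in>S. 1 \<in> st I \<longleftrightarrow> I \<in> J" using fin[OF S] by blast
    then show ?thesis
      using localizing_SStar[of st] S(2) by (intro exI[of _ "{I \<in> fg_ideals. 1 \<in> st I}"]) (auto simp: SStar_f_sp_def)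
  qed
  show ?thesis
    unfolding localizing_def
  proof (intro conjI ballI allI impI)
    show "range of_dom \<in> J"
      using approx[of "{range of_dom}"] range_fg_ideals localizingD(2) by auto
    show "I' \<in> J" if I: "I \<in> J" "I' \<in> fg_ideals" "I \<subseteq> I'" for I I'
      using approx[of "{I, I'}"] I J localizingD(3)[of _ I I'] by auto
    show "combine S H \<in> J" if "finite S \<and> generated_submodule S \<in> J \<and> (\<forall>a\<in>S. H a \<in> J)" for S H
    proof -
      have Q: "combine S H \<in> fg_ideals" using that J by (intro combine_fg_ideals) auto
      have "finite ({generated_submodule S, combine S H} \<union> H ` S)"
        "{generated_submodule S, combine S H} \<union> H ` S \<subseteq> fg_ideals"
        using that Q J by auto
      from approx[OF this] obtain J' where J': "localizing J'"
        "\<forall>I\<in>{generated_submodule S, combine S H} \<union> H ` S. I \<in> J' \<longleftrightarrow> I \<in> J" by blast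
      have "combine S H \<in> J'" using that J'(2) by (intro localizingD(4)[OF J'(1)]) auto
      then show ?thesis using J'(2) by simp
    qed
  qed (rule J)
qed

section \<open>The space of stable semistar operations of finite type\<close>

theorem theorem4p6:
  shows "spectral_space
    (subtopology (Zariski_SStar :: ('a::idom fract set \<Rightarrow> 'a fract set) topology) SStar_f_sp)"
proof -
  let ?\<B> = "basic_open ` (fg_ideals :: 'a fract set set)"
  have mem: "st \<in> basic_open I \<longleftrightarrow> 1 \<in> st I" if "st \<in> SStar_f_sp"
    for st :: "'a fract set \<Rightarrow> 'a fract set" and I
    using that by (simp add: basic_open_def)
  have "spectral_space (topology_generated_by ?\<B>)"
  proof (rule spectral_space_patch_closed)
    fix st st' assume st: "st \<in> \<Union>?\<B>" "st' \<in> \<Union>?\<B>" "{B \<in> ?\<B>. st \<in> B} = {B \<in> ?\<B>. st' \<in> B}"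
    then have sp: "st \<in> SStar_f_sp" "st' \<in> SStar_f_sp" unfolding Union_basic_open by auto
    show "st = st'"
    proof (rule SStar_f_sp_eqI[OF sp])
      fix I :: "'a fract set" assume "I \<in> fg_ideals"
      then have "st \<in> basic_open I \<longleftrightarrow> st' \<in> basic_open I" using st(3) by blast
      then show "1 \<in> st I \<longleftrightarrow> 1 \<in> st' I" using mem sp by simp
    qed
  next
    fix J assume J: "J \<subseteq> ?\<B>"
      and fin: "\<And>S. finite S \<Longrightarrow> S \<subseteq> ?\<B> \<Longrightarrow> \<exists>st\<in>\<Union>?\<B>. {B \<in> ?\<B>. st \<in> B} \<inter> S = J \<inter> S"
    define J' where "J' = {I \<in> fg_ideals. basic_open I \<in> J}"
    have "localizing J'"
    proof (rule localizing_limit)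
      fix S :: "'a fract set set" assume S: "finite S" "S \<subseteq> fg_ideals"
      then have "finite (basic_open ` S)" "basic_open ` S \<subseteq> ?\<B>" by auto
      from fin[OF this] obtain st where
        st: "st \<in> SStar_f_sp" "{B \<in> ?\<B>. st \<in> B} \<inter> basic_open ` S = J \<inter> basic_open ` S"
        unfolding Union_basic_open by (elim bexE)
      have "1 \<in> st I \<longleftrightarrow> I \<in> J'" if "I \<in> S" for I
      proof -
        have "st \<in> basic_open I \<longleftrightarrow> basic_open I \<in> J" using st(2) that S(2) by blast
        then show ?thesis using mem[OF st(1)] that S(2) by (auto simp: J'_def)
      qed
      then show "\<exists>st\<in>SStar_f_sp. \<forall>I\<in>S. 1 \<in> st I \<longleftrightarrow> I \<in> J'" using st(1) by blast
    qed (simp add: J'_def)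
    note st = semistar_of_SStar_f_sp[OF this] and one = one_mem_semistar_of[OF this]
    have "semistar_of J' \<in> B \<longleftrightarrow> B \<in> J" if "B \<in> ?\<B>" for B
    proof -
      from that obtain I where I: "I \<in> fg_ideals" "B = basic_open I" by blast
      then show ?thesis using mem[OF st] one[OF I(1)] by (simp add: J'_def)
    qed
    then have "{B \<in> ?\<B>. semistar_of J' \<in> B} = J" using J by blast
    moreover have "semistar_of J' \<in> \<Union>?\<B>" unfolding Union_basic_open by (rule st)
    ultimately show "\<exists>st\<in>\<Union>?\<B>. {B \<in> ?\<B>. st \<in> B} = J" by blast
  qed
  then show ?thesis unfolding Zariski_SStar_f_sp .
qed

end
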